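(* Let $f_0 \in C_c^1(\mathbb{R}^3)$, $f_0=f_0(x,v)\ge 0$ with $x\in\mathbb{R}$, $v=(v_1,v_2)\in\mathbb{R}^2$, be not identically equal to zero, and let $f$ be the corresponding global solution of the monocharged relativistic Vlasov-Poisson system with $f(0,x,v)=f_0(x,v)$ and charge density $\rho(t,x)=\int_{\mathbb{R}^2} f(t,x,v)\,dv$. Then there exists $C>0$ such that $$\Vert \rho(t)\Vert_p \ge C \quad\text{for all } t\ge 0 \text{ and all } p\in[1,\infty].$$
   Context: The monocharged ``one and one-half dimensional'' relativistic Vlasov-Poisson system, for the unknown $f=f(t,x,v)\ge 0$ (particle number density), $t\ge 0$, $x\in\mathbb{R}$, $v=(v_1,v_2)\in\mathbb{R}^2$, is $$\partial_t f+\hat v_1\,\partial_x f+E_1\,\partial_{v_1}f=0,\qquad \rho(t,x)=\int_{\mathbb{R}^2} f(t,x,v)\,dv,$$ $$E_1(t,x)=\frac12\left(\int_{-\infty}^x\rho(t,y)\,dy-\int_x^\infty\rho(t,y)\,dy\right),$$ where $\hat v=v/\sqrt{1+|v|^2}$, so $\hat v_1=v_1/\sqrt{1+v_1^2+v_2^2}$. For initial data $f(0,x,v)=f_0(x,v)$ that are $C^1$, nonnegative and compactly supported, it is known that there is a solution that is $C^1$ for all $t\ge0$, with $f(t,\cdot,\cdot)$ compactly supported for each $t\geq 0$; solutions are understood in this sense. $\Vert\rho(t)\Vert_p$ is the $L^p(\mathbb{R})$ norm of $x\mapsto\rho(t,x)$. The constant $C$ may depend on $f_0$ but not on $t$ or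 $p$. *)

theory Defs
  imports "HOL-Analysis.Analysis" "HOL-Probability.Essential_Supremum"
begin

text \<open>
  Phase space is \<open>real \<times> (real \<times> real)\<close> with points \<open>(x, v)\<close>, \<open>v = (v1, v2)\<close>. A density
  \<open>f t x v\<close> is a total function of \<open>t :: real\<close>, but only its values for \<open>t \<ge> 0\<close> are ever used.
\<close>

text \<open>
  Used for \<open>S = UNIV\<close> and for \<open>S = {0..} \<times> UNIV\<close>; on the latter the derivatives in time
  at the boundary points \<open>t = 0\<close> are one-sided, and the derivative is unique at every point of \<open>S\<close>.
\<close>
definition continuously_differentiable_on ::
    "('a::real_normed_vector \<Rightarrow> 'b::real_normed_vector) \<Rightarrow> 'a set \<Rightarrow> bool"
    (infix "continuously'_differentiable'_on" 50) where
  "F continuously_differentiable_on S \<longleftrightarrow>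
     (\<exists>F' :: 'a \<Rightarrow> 'a \<Rightarrow>\<^sub>L 'b.
        (\<forall>z\<in>S. (F has_derivative blinfun_apply (F' z)) (at z within S)) \<and> continuous_on S F')"

definition compactly_supported :: "('a::topological_space \<Rightarrow> real) \<Rightarrow> bool" where
  "compactly_supported F \<longleftrightarrow> compact (closure (support_on UNIV F))"

definition rel_velocity :: "real \<times> real \<Rightarrow> real \<times> real" where
  "rel_velocity v = v /\<^sub>R sqrt (1 + (norm v)\<^sup>2)"

definition charge_density :: "(real \<Rightarrow> real \<Rightarrow> real \<times> real \<Rightarrow> real) \<Rightarrow> real \<Rightarrow> real \<Rightarrow> real" where
  "charge_density f t x = (LINT v|lborel. f t x v)"

definition electric_field :: "(real \<Rightarrow> real \<Rightarrow> real \<times> real \<Rightarrow> real) \<Rightarrow> real \<Rightarrow> real \<Rightarrow> real" where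
  "electric_field f t x =
     ((LINT y:{..x}|lborel. charge_density f t y) -
      (LINT y:{x..}|lborel. charge_density f t y)) / 2"

definition vlasov_equation :: "(real \<Rightarrow> real \<Rightarrow> real \<times> real \<Rightarrow> real) \<Rightarrow> bool" where
  "vlasov_equation f \<longleftrightarrow>
     (\<forall>t\<ge>0. \<forall>x v1 v2.
        vector_derivative (\<lambda>s. f s x (v1, v2)) (at t within {0..})
        + fst (rel_velocity (v1, v2)) * deriv (\<lambda>y. f t y (v1, v2)) x
        + electric_field f t x * deriv (\<lambda>u. f t x (u, v2)) v1 = 0)"

definition global_solution ::
    "(real \<Rightarrow> real \<times> real \<Rightarrow> real) \<Rightarrow> (real \<Rightarrow> real \<Rightarrow> real \<times> real \<Rightarrow> real) \<Rightarrow> bool" where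
  "global_solution f0 f \<longleftrightarrow>
     (\<lambda>(t, x, v). f t x v) continuously_differentiable_on ({0..} \<times> UNIV) \<and>
     (\<forall>t\<ge>0. compactly_supported (\<lambda>(x, v). f t x v)) \<and>
     (\<forall>t\<ge>0. \<forall>x v. f t x v \<ge> 0) \<and>
     vlasov_equation f \<and>
     (\<forall>x v. f 0 x v = f0 x v)"

text \<open>
  The extended-valued \<open>L\<^sup>p\<close> norm on the real line; it is meant for \<open>1 \<le> p \<le> \<infinity>\<close>.
  Values in \<^typ>\<open>ennreal\<close> make the norm of a function outside \<open>L\<^sup>p\<close> infinite instead of zero.
\<close>
definition Lp_norm :: "ennreal \<Rightarrow> (real \<Rightarrow> real) \<Rightarrow> ennreal" where
  "Lp_norm p g =
     (if p = \<infinity> then esssup lborel (\<lambda>x. ennreal \<bar>g x\<bar>)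
      else let I = (\<integral>\<^sup>+ x. ennreal (\<bar>g x\<bar> powr enn2real p) \<partial>lborel) in
        if I = \<infinity> then \<infinity> else ennreal (enn2real I powr (1 / enn2real p)))"

end

(*
  Let M be the (conserved) mass. The field E satisfies E_x = rho and E_t = -j, where j is the current,
  and increases in x from -M/2 to M/2. Put chi(e) = max(0, e - M/4)^2 and
  W(v) = (v1 - sqrt(1 + |v|^2)) / sqrt(1 + v2^2) = - sqrt((1 - vh1) / (1 + vh1)) <= 0,
  an increasing function of the velocity vh1 with dW/dv1 = (1 - vh1) / sqrt(1 + v2^2). For a suitable
  c > 0 the functional int chi(E) (c (x - t) + W) f is nondecreasing in time: the terms containing
  chi' combine to a nonnegative one by Chebyshev's inequality, and on the support of chi(E), where
  E >= M/4, the gain E dW/dv1 exceeds the loss c (1 - vh1), because v2 stays bounded. Hence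
  int chi(E) (x - t) rho is bounded below. Since int chi(E) rho dx = (M/4)^3 / 3 for all t and
  x <= R + t on the support, a fixed amount of charge stays in a window [t - L, t + R], and convexity
  of y^p gives the lower bounds of the norms.

  Solutions are only assumed to be compactly supported at each time, so local boundedness of the mass
  has to be proved before any differentiation under the integral sign.
*)
theory Submission
  imports Defs
begin

text \<open>Charge in the region where E is positive is pushed to the right and should trail the
  light ray x = t by a bounded distance. Along a trajectory x - t decreases at the rate 1 - vh1, so
  it has to be balanced by a function of v, bounded above, whose v1-derivative is comparable to 1 -
  vh1. The function v1 - sqrt(1 + |v|^2) has exactly this derivative. Dividing it by sqrt(1 + v2^2),
  which is constant along trajectories, changes the gain by a bounded factor only and leaves a
  function of vh1 alone; that gives Chebyshev's inequality its two similarly ordered functions. The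
  sign of W lets it be dropped at the final time, although W is unbounded below.

  The preliminary obstacle is a circle: conservation of mass needs a common support on a time
  interval, the support is controlled by the field, and the field by the mass. Any bound on the mass
  breaks the circle; lower semicontinuity of the mass and Baire's theorem supply one.\<close>

section \<open>Norms, powers and integrals on the line\<close>

text \<open>Bernoulli's inequality for a real exponent, scaled to the base point \<open>l\<close>.
  Integrated over an interval on which the mean of \<open>y\<close> is at least \<open>l\<close>, it
  takes the place of Jensen's inequality.\<close>

lemma powr_ge_tangent:
  fixes y l p :: real
  assumes "0 \<le> y" "0 < l" "1 \<le> p"
  shows "l powr p * (1 + p * (y / l - 1)) \<le> y powr p"
proof -
  define z where "z = y / l"
  have z: "0 \<le> z" "y = z * l" using assms by (auto simp: z_def)
  have "1 + p * (z - 1) \<le> z powr p"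
  proof (cases "z = 0")
    case True
    then show ?thesis using assms by simp
  next
    case False
    then have zp: "0 < z" using z by simp
    have "1 + (p - 1) * ln z \<le> z powr (p - 1)"
      using exp_ge_add_one_self[of "(p - 1) * ln z"] zp by (simp add: powr_def)
    then have "z * (1 + (p - 1) * ln z) \<le> z * z powr (p - 1)"
      using zp by (intro mult_left_mono) auto
    also have "\<dots> = z powr p" using zp by (simp add: powr_diff)
    finally have 1: "z + (p - 1) * (z * ln z) \<le> z powr p" by (simp add: algebra_simps)
    have "ln (1 / z) \<le> 1 / z - 1" using zp by (intro ln_le_minus_one) auto
    then have "z * ln (1 / z) \<le> z * (1 / z - 1)" using zp by (intro mult_left_mono) auto
    then have "z - 1 \<le> z * ln z" using zp by (simp add: ln_div algebra_simps)
    then have "(p - 1) * (z - 1) \<le> (p - 1) * (z * ln z)" using assms by (intro mult_left_mono) auto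
    with 1 show ?thesis by (simp add: algebra_simps)
  qed
  then have "l powr p * (1 + p * (z - 1)) \<le> l powr p * z powr p" by (intro mult_left_mono) auto
  also have "\<dots> = y powr p" using z assms by (simp add: powr_mult)
  finally show ?thesis by (simp add: z_def)
qed

lemma compact_support_lborel:
  fixes g :: "'a::euclidean_space \<Rightarrow> real"
  assumes "continuous_on UNIV g" "\<And>x. x \<notin> cbox a b \<Longrightarrow> g x = 0"
  shows "integrable lborel g" "(LINT x|lborel. g x) = integral (cbox a b) g"
proof -
  have eq: "(\<lambda>x. indicator (cbox a b) x *\<^sub>R g x) = g" using assms(2) by (auto simp: indicator_def fun_eq_iff)
  have i: "set_integrable lborel (cbox a b) g"
    unfolding set_integrable_def
    by (rule borel_integrable_compact) (auto intro: continuous_on_subset[OF assms(1)])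
  then show "integrable lborel g" by (simp only: set_integrable_def eq)
  show "(LINT x|lborel. g x) = integral (cbox a b) g"
    using set_borel_integral_eq_integral(2)[OF i] by (simp only: set_lebesgue_integral_def eq)
qed

lemma Lp_norm_ge_average:
  fixes g :: "real \<Rightarrow> real"
  assumes g: "continuous_on UNIV g" "\<And>x. 0 \<le> g x" "\<And>x. x \<notin> {- r..r} \<Longrightarrow> g x = 0"
    and len: "1 \<le> d - c" and \<delta>: "0 < \<delta>" "\<delta> \<le> integral {c..d} g"
    and p: "p \<in> {1..\<infinity>}"
  shows "ennreal (\<delta> / (d - c)) \<le> Lp_norm p g"
proof -
  define l where "l = \<delta> / (d - c)"
  have l: "0 < l" "l * (d - c) = \<delta>" using len \<delta> by (auto simp: l_def)
  have gi: "g integrable_on {c..d}" by (intro integrable_continuous_real continuous_on_subset[OF g(1)]) auto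
  have gm: "g \<in> borel_measurable lborel" using g(1) by (simp add: borel_measurable_continuous_onI)
  show ?thesis
  proof (cases "p = \<infinity>")
    case True
    define S where "S = esssup lborel (\<lambda>x. ennreal \<bar>g x\<bar>)"
    have "ennreal l \<le> S"
    proof (rule ccontr)
      assume "\<not> ennreal l \<le> S"
      then have less: "S < ennreal l" by simp
      then obtain s where s: "S = ennreal s" "0 \<le> s" by (cases S) auto
      have sl: "s < l" using less s l by (simp add: ennreal_less_iff)
      have ae: "AE x in lborel. g x \<le> s"
        using esssup_AE[of "\<lambda>x. ennreal \<bar>g x\<bar>" lborel]
      proof eventually_elim
        case (elim x)
        then show ?case using s g(2)[of x] by (simp add: S_def[symmetric])
      qed
      have i: "set_integrable lborel {c..d} g" "set_integrable lborel {c..d} (\<lambda>x. s)"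
        unfolding set_integrable_def
        by (rule borel_integrable_compact; auto intro!: continuous_on_subset[OF g(1)])+
      have "(LINT x:{c..d}|lborel. g x) \<le> (LINT x:{c..d}|lborel. s)"
        by (rule set_integral_mono_AE[OF i]) (use ae in auto)
      then have "integral {c..d} g \<le> s * (d - c)"
        using set_borel_integral_eq_integral(2)[OF i(1)] len by (simp add: set_borel_integral_eq_integral(2)[OF i(2)] mult.commute)
      moreover have "s * (d - c) < l * (d - c)" using sl len by (intro mult_strict_right_mono) auto
      ultimately show False using l \<delta> by simp
    qed
    then show ?thesis using True by (simp add: Lp_norm_def S_def l_def)
  next
    case False
    define q where "q = enn2real p"
    have q: "1 \<le> q"
      using p False by (cases p) (auto simp: q_def)
    define h where "h = (\<lambda>x. \<bar>g x\<bar> powr q)"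
    have hc: "continuous_on UNIV h" unfolding h_def
      using q by (intro continuous_on_powr' continuous_intros g(1)) auto
    have h0: "h x = 0" if "x \<notin> cbox (- r) r" for x using g(3)[of x] that by (simp add: h_def)
    note hL = compact_support_lborel[OF hc h0]
    define J where "J = (LINT x|lborel. h x)"
    have I: "(\<integral>\<^sup>+ x. ennreal (\<bar>g x\<bar> powr enn2real p) \<partial>lborel) = ennreal J"
      unfolding J_def h_def[symmetric] q_def[symmetric]
      using nn_integral_eq_integral[OF hL(1)] by (simp add: h_def)
    have hi: "h integrable_on {c..d}" by (intro integrable_continuous_real continuous_on_subset[OF hc]) auto
    \<comment> \<open>The added term is nonnegative because the integral of \<open>g\<close> is at
      least \<open>l * (d - c)\<close>. The right-hand side is the integral of the tangent.\<close>
    have "l powr q * (d - c) \<le> l powr q * ((d - c) + q * (integral {c..d} g / l - (d - c)))"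
      using q l \<delta> by (intro mult_left_mono) (auto simp: field_simps)
    also have "\<dots> = integral {c..d} (\<lambda>x. l powr q * (1 + q * (g x / l - 1)))"
    proof -
      have one: "((\<lambda>x. 1::real) has_integral (d - c)) {c..d}"
        using has_integral_const_real[of "1::real" c d] len by simp
      have "((\<lambda>x. l powr q * (1 + q * (g x / l - 1))) has_integral
          l powr q * (1 * (d - c) + q * (integral {c..d} g / l - 1 * (d - c)))) {c..d}"
        using one integrable_integral[OF gi]
        by (intro has_integral_mult_right has_integral_add has_integral_diff has_integral_divide) auto
      from integral_unique[OF this] show ?thesis by (simp only: mult_1)
    qed
    also have "\<dots> \<le> integral {c..d} h"
    proof (rule integral_le[OF _ hi])
      show "(\<lambda>x. l powr q * (1 + q * (g x / l - 1))) integrable_on {c..d}"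
        using l by (intro integrable_continuous_real continuous_intros continuous_on_subset[OF g(1)]) auto
    qed (use powr_ge_tangent[OF g(2) l(1) q] g(2) in \<open>auto simp: h_def\<close>)
    also have "\<dots> \<le> J"
    proof -
      have i: "set_integrable lborel {c..d} h"
        unfolding set_integrable_def
        by (rule borel_integrable_compact; auto intro!: continuous_on_subset[OF hc])
      have "integral {c..d} h = (LINT x:{c..d}|lborel. h x)"
        by (rule set_borel_integral_eq_integral(2)[OF i, symmetric])
      also have "\<dots> \<le> J" unfolding set_lebesgue_integral_def J_def
        using i hL(1) by (intro integral_mono) (auto simp: set_integrable_def indicator_def h_def)
      finally show ?thesis .
    qed
    finally have J: "l powr q * (d - c) \<le> J" .
    have "l powr q * 1 \<le> l powr q * (d - c)" using len by (intro mult_left_mono) auto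
    with J have J': "l powr q \<le> J" by simp
    have "l = (l powr q) powr (1 / q)" using l q by (simp add: powr_powr)
    also have "\<dots> \<le> J powr (1 / q)" using J' q by (intro powr_mono2) auto
    finally have "l \<le> J powr (1 / q)" .
    moreover have "0 \<le> J" using J' by (smt (verit) powr_ge_zero)
    ultimately show ?thesis using False
      by (simp add: Lp_norm_def I[folded q_def] Let_def l_def[symmetric] q_def[symmetric] ennreal_leI)
  qed
qed

text \<open>An exponent of at least two removes the kink at \<open>a\<close>. Exponent two serves
  the cutoff of the field, exponent three its antiderivative.\<close>

lemma DERIV_max_zero_power:
  fixes a x :: real
  shows "((\<lambda>y. max 0 (y - a) ^ Suc (Suc n)) has_real_derivative
           real (Suc (Suc n)) * max 0 (x - a) ^ Suc n) (at x)"
proof -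
  consider "x < a" | "x > a" | "x = a" by linarith
  then show ?thesis
  proof cases
    case 1
    have "((\<lambda>y. 0::real) has_real_derivative 0) (at x)" by simp
    then have "((\<lambda>y. max 0 (y - a) ^ Suc (Suc n)) has_real_derivative 0) (at x)"
      by (rule has_field_derivative_transform_within_open[of _ _ _ "{..<a}"]) (use 1 in auto)
    then show ?thesis using 1 by simp
  next
    case 2
    have "((\<lambda>y. (y - a) ^ Suc (Suc n)) has_real_derivative
        real (Suc (Suc n)) * (x - a) ^ Suc n) (at x)"
      by (auto intro!: derivative_eq_intros simp del: power_Suc)
    then have "((\<lambda>y. max 0 (y - a) ^ Suc (Suc n)) has_real_derivative
        real (Suc (Suc n)) * (x - a) ^ Suc n) (at x)"
      by (rule has_field_derivative_transform_within_open[of _ _ _ "{a<..}"]) (use 2 in auto)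
    then show ?thesis using 2 by simp
  next
    case 3
    have *: "((\<lambda>h. max 0 h ^ Suc (Suc n) / h) \<longlongrightarrow> 0) (at (0::real))"
    proof (rule Lim_null_comparison)
      show "\<forall>\<^sub>F h in at (0::real). norm (max 0 h ^ Suc (Suc n) / h) \<le> \<bar>h\<bar> ^ Suc n"
        by (intro always_eventually allI) (auto simp: max_def abs_mult power_abs intro: mult_nonpos_nonneg)
      have "((\<lambda>h. \<bar>h\<bar> ^ Suc n) \<longlongrightarrow> \<bar>0\<bar> ^ Suc n) (at (0::real))" by (intro tendsto_intros)
      then show "((\<lambda>h. \<bar>h\<bar> ^ Suc n) \<longlongrightarrow> 0) (at (0::real))" by simp
    qed
    then show ?thesis using 3 by (simp add: DERIV_def)
  qed
qed

text \<open>After exchanging the integrals, each derivative is integrated in its own variable. The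
  derivatives are taken within the intervals: the time derivative is one-sided at time 0, and the
  formula for the field is used on a bounded interval.\<close>

lemma divergence_theorem_rectangle:
  fixes A F At Fx :: "real \<Rightarrow> real \<Rightarrow> real"
  assumes "a \<le> b" "c \<le> d"
    and At: "\<And>t x. t \<in> {a..b} \<Longrightarrow> x \<in> {c..d} \<Longrightarrow> ((\<lambda>t. A t x) has_vector_derivative At t x) (at t within {a..b})"
    and Fx: "\<And>t x. t \<in> {a..b} \<Longrightarrow> x \<in> {c..d} \<Longrightarrow> ((\<lambda>x. F t x) has_vector_derivative Fx t x) (at x within {c..d})"
    and cA: "continuous_on ({a..b} \<times> {c..d}) (\<lambda>(t, x). At t x)"
    and cF: "continuous_on ({a..b} \<times> {c..d}) (\<lambda>(t, x). Fx t x)"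
    and iA: "A a integrable_on {c..d}" "A b integrable_on {c..d}"
  shows "integral {a..b} (\<lambda>t. integral {c..d} (\<lambda>x. At t x + Fx t x)) =
    integral {c..d} (A b) - integral {c..d} (A a) + integral {a..b} (\<lambda>t. F t d - F t c)"
proof -
  have s: "continuous_on {c..d} (\<lambda>x. At t x)" "continuous_on {c..d} (\<lambda>x. Fx t x)" if "t \<in> {a..b}" for t
  proof -
    have "continuous_on {c..d} (Pair t)" "Pair t ` {c..d} \<subseteq> {a..b} \<times> {c..d}"
      using that by (auto intro!: continuous_intros)
    from continuous_on_compose2[OF cA this] continuous_on_compose2[OF cF this]
    show "continuous_on {c..d} (\<lambda>x. At t x)" "continuous_on {c..d} (\<lambda>x. Fx t x)" by simp_all
  qed
  have 1: "integral {c..d} (\<lambda>x. At t x + Fx t x) = integral {c..d} (At t) + (F t d - F t c)"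
    if t: "t \<in> {a..b}" for t
  proof -
    have "integral {c..d} (\<lambda>x. At t x + Fx t x) = integral {c..d} (At t) + integral {c..d} (Fx t)"
      using s[OF t] by (intro integral_add integrable_continuous_real) auto
    also have "integral {c..d} (Fx t) = F t d - F t c"
      by (rule integral_unique[OF fundamental_theorem_of_calculus]) (use t Fx assms in auto)
    finally show ?thesis .
  qed
  have cA2: "continuous_on {a..b} (\<lambda>t. integral {c..d} (At t))"
    using integral_continuous_on_param[of "{a..b}" c d At] cA by simp
  have cF2: "continuous_on {a..b} (\<lambda>t. integral {c..d} (Fx t))"
    using integral_continuous_on_param[of "{a..b}" c d Fx] cF by simp
  have "integral {c..d} (Fx t) = F t d - F t c" if "t \<in> {a..b}" for t
    by (rule integral_unique[OF fundamental_theorem_of_calculus]) (use that Fx assms in auto)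
  then have cF3: "continuous_on {a..b} (\<lambda>t. F t d - F t c)"
    by (rule continuous_on_eq[OF cF2])
  have "integral {a..b} (\<lambda>t. integral {c..d} (\<lambda>x. At t x + Fx t x)) =
      integral {a..b} (\<lambda>t. integral {c..d} (At t) + (F t d - F t c))"
    using 1 by (intro integral_cong) auto
  also have "\<dots> = integral {a..b} (\<lambda>t. integral {c..d} (At t)) + integral {a..b} (\<lambda>t. F t d - F t c)"
    using cA2 cF3 by (intro integral_add integrable_continuous_real) auto
  also have "integral {a..b} (\<lambda>t. integral {c..d} (At t)) = integral {c..d} (\<lambda>x. integral {a..b} (\<lambda>t. At t x))"
    using integral_swap_continuous[of a c b d At] cA by (simp add: cbox_Pair_eq)
  also have "\<dots> = integral {c..d} (\<lambda>x. A b x - A a x)"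
    by (intro integral_cong integral_unique[OF fundamental_theorem_of_calculus]) (use At assms in auto)
  also have "\<dots> = integral {c..d} (A b) - integral {c..d} (A a)"
    using iA by (intro integral_diff) auto
  finally show ?thesis .
qed

subsection \<open>Finite propagation speed\<close>

text \<open>Strict bounds make the density vanish on the faces of the cube, which removes the
  boundary terms in integrations over it.\<close>

definition supported_in :: "(real \<Rightarrow> real \<times> real \<Rightarrow> real) \<Rightarrow> real \<Rightarrow> bool" where
  "supported_in h r \<longleftrightarrow> (\<forall>x u w. h x (u, w) \<noteq> 0 \<longrightarrow> \<bar>x\<bar> < r \<and> \<bar>u\<bar> < r \<and> \<bar>w\<bar> < r)"

definition energy :: "real \<times> real \<Rightarrow> real" where
  "energy v = sqrt (1 + (fst v)\<^sup>2 + (snd v)\<^sup>2)"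

definition vhat :: "real \<times> real \<Rightarrow> real" where
  "vhat v = fst v / energy v"

lemma energy_gt: "\<bar>fst v\<bar> < energy v"
proof -
  have "\<bar>fst v\<bar> = sqrt ((fst v)\<^sup>2)" by simp
  also have "\<dots> < energy v" unfolding energy_def
    by (rule real_sqrt_less_mono) (smt (verit) zero_le_power2)
  finally show ?thesis .
qed

lemma energy_pos: "0 < energy v"
  using energy_gt[of v] by linarith

lemma abs_vhat_less: "\<bar>vhat v\<bar> < 1"
  using energy_gt[of v] energy_pos[of v] by (simp add: vhat_def)

lemma continuous_on_energy [continuous_intros]: "continuous_on S energy"
  unfolding energy_def by (intro continuous_intros)

lemma continuous_on_vhat [continuous_intros]: "continuous_on S vhat"
  unfolding vhat_def using energy_pos by (intro continuous_intros) (auto simp: less_imp_neq[symmetric])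

lemma rel_velocity_eq_vhat: "fst (rel_velocity v) = vhat v"
  by (cases v) (simp add: rel_velocity_def vhat_def energy_def norm_Pair divide_inverse add.assoc mult.commute)

text \<open>The partial derivatives are parameters, so that they can stand under integrals. The
  joint derivative is kept because finite propagation differentiates along oblique lines.\<close>

locale C1_density =
  fixes f ft fx fu fw :: "real \<Rightarrow> real \<Rightarrow> real \<times> real \<Rightarrow> real"
  assumes deriv: "\<And>t x u w. 0 \<le> t \<Longrightarrow> ((\<lambda>(t, x, v). f t x v) has_derivative
      (\<lambda>(a, b, c, d). ft t x (u, w) * a + fx t x (u, w) * b + fu t x (u, w) * c + fw t x (u, w) * d))
      (at (t, x, u, w) within {0..} \<times> UNIV)"
    and cont_ft: "continuous_on ({0..} \<times> UNIV) (\<lambda>(t, x, v). ft t x v)"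
    and cont_fx: "continuous_on ({0..} \<times> UNIV) (\<lambda>(t, x, v). fx t x v)"
    and cont_fu: "continuous_on ({0..} \<times> UNIV) (\<lambda>(t, x, v). fu t x v)"
begin

text \<open>Chain rule within \<open>S\<close>, so that a curve may start or end at time 0. Curves
  moving in one coordinate only give the partial derivatives.\<close>

lemma deriv_curve:
  fixes T X U V :: "real \<Rightarrow> real"
  assumes "\<And>r. r \<in> S \<Longrightarrow> 0 \<le> T r" "s \<in> S"
    and "(T has_real_derivative T') (at s within S)" "(X has_real_derivative X') (at s within S)"
      "(U has_real_derivative U') (at s within S)" "(V has_real_derivative V') (at s within S)"
  shows "((\<lambda>r. f (T r) (X r) (U r, V r)) has_real_derivative
    ft (T s) (X s) (U s, V s) * T' + fx (T s) (X s) (U s, V s) * X' +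
    fu (T s) (X s) (U s, V s) * U' + fw (T s) (X s) (U s, V s) * V') (at s within S)"
proof -
  let ?c = "\<lambda>r. (T r, X r, U r, V r)"
  have 1: "(?c has_derivative (\<lambda>h. (T' * h, X' * h, U' * h, V' * h))) (at s within S)"
    using assms(3-6) unfolding has_field_derivative_def by (intro has_derivative_Pair)
  have 2: "((\<lambda>(t, x, v). f t x v) has_derivative
      (\<lambda>(a, b, c, d). ft (T s) (X s) (U s, V s) * a + fx (T s) (X s) (U s, V s) * b +
        fu (T s) (X s) (U s, V s) * c + fw (T s) (X s) (U s, V s) * d)) (at (?c s) within ?c ` S)"
    by (rule has_derivative_subset[OF deriv]) (use assms(1,2) in auto)
  from has_derivative_in_compose[OF 1 2] show ?thesis
    unfolding has_field_derivative_def prod.case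
    by (rule has_derivative_eq_rhs) (auto simp: algebra_simps fun_eq_iff)
qed

lemma deriv_t: "0 \<le> t \<Longrightarrow> ((\<lambda>s. f s x v) has_real_derivative ft t x v) (at t within {0..})"
  using deriv_curve[of "{0..}" "\<lambda>s. s" t 1 "\<lambda>_. x" 0 "\<lambda>_. fst v" 0 "\<lambda>_. snd v" 0] by simp

lemma deriv_x: "0 \<le> t \<Longrightarrow> ((\<lambda>y. f t y v) has_real_derivative fx t x v) (at x)"
  using deriv_curve[of UNIV "\<lambda>s. t" x 0 "\<lambda>y. y" 1 "\<lambda>_. fst v" 0 "\<lambda>_. snd v" 0] by simp

lemma deriv_u: "0 \<le> t \<Longrightarrow> ((\<lambda>z. f t x (z, w)) has_real_derivative fu t x (u, w)) (at u)"
  using deriv_curve[of UNIV "\<lambda>s. t" u 0 "\<lambda>_. x" 0 "\<lambda>z. z" 1 "\<lambda>_. w" 0] by simp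

lemma cont_f: "continuous_on ({0..} \<times> UNIV) (\<lambda>(t, x, v). f t x v)"
  by (rule has_derivative_continuous_on[where f' = "\<lambda>(t, x, u, w) (a, b, c, d).
      ft t x (u, w) * a + fx t x (u, w) * b + fu t x (u, w) * c + fw t x (u, w) * d"])
    (use deriv in auto)

end

locale vlasov_poisson = C1_density +
  assumes pde: "\<And>t x v. 0 \<le> t \<Longrightarrow> ft t x v + vhat v * fx t x v + electric_field f t x * fu t x v = 0"
    and nonneg: "\<And>t x v. 0 \<le> t \<Longrightarrow> 0 \<le> f t x v"
    and supp: "\<And>t. 0 \<le> t \<Longrightarrow> \<exists>r>0. supported_in (f t) r"
begin

abbreviation E where "E \<equiv> electric_field f"
abbreviation \<rho> where "\<rho> \<equiv> charge_density f"
definition mass :: "real \<Rightarrow> real" where "mass t = (LINT x|lborel. \<rho> t x)"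

text \<open>
  At a positive maximum of \<open>exp (- t) * f\<close> over the backward cone, \<open>f\<close> is stationary along the
  backward characteristic direction, so \<open>exp (- t) * f\<close> increases into the cone. Only a bound on the
  field is needed, not its continuity.
\<close>
lemma finite_propagation:
  assumes "0 \<le> a" "a \<le> b" and bnd: "\<And>t x. t \<in> {a..b} \<Longrightarrow> \<bar>E t x\<bar> \<le> N"
    and pos: "f b x (u, w) \<noteq> 0"
  shows "\<exists>y z. \<bar>y - x\<bar> \<le> b - a \<and> \<bar>z - u\<bar> \<le> N * (b - a) \<and> f a y (z, w) \<noteq> 0"
proof -
  define K where "K = {(t, y, z). a \<le> t \<and> t \<le> b \<and> \<bar>y - x\<bar> \<le> b - t \<and> \<bar>z - u\<bar> \<le> N * (b - t)}"
  define G where "G = (\<lambda>(t, y, z). exp (- t) * f t y (z, w))"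
  have N: "0 \<le> N" using bnd[of a 0] assms(2) by (smt (verit) atLeastAtMost_iff)
  have "closed K"
  proof -
    have "K = {p. a \<le> fst p} \<inter> {p. fst p \<le> b} \<inter> {p. \<bar>fst (snd p) - x\<bar> \<le> b - fst p} \<inter>
        {p. \<bar>snd (snd p) - u\<bar> \<le> N * (b - fst p)}" by (auto simp: K_def)
    also have "closed \<dots>" by (intro closed_Int closed_Collect_le continuous_intros)
    finally show ?thesis .
  qed
  moreover have "K \<subseteq> cbox (a, x - (b - a), u - N * (b - a)) (b, x + (b - a), u + N * (b - a))"
  proof
    fix p assume "p \<in> K"
    then obtain t y z where p: "p = (t, y, z)" "a \<le> t" "t \<le> b" "\<bar>y - x\<bar> \<le> b - t" "\<bar>z - u\<bar> \<le> N * (b - t)"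
      by (auto simp: K_def)
    have "N * (b - t) \<le> N * (b - a)" using N p by (intro mult_left_mono) auto
    then show "p \<in> cbox (a, x - (b - a), u - N * (b - a)) (b, x + (b - a), u + N * (b - a))"
      using p by (auto simp: cbox_Pair_eq)
  qed
  ultimately have K: "compact K" by (metis bounded_cbox bounded_subset compact_eq_bounded_closed)
  have "(b, x, u) \<in> K" using assms by (auto simp: K_def)
  moreover have "continuous_on K G"
  proof -
    have "continuous_on K (\<lambda>p. (fst p, fst (snd p), snd (snd p), w))" by (intro continuous_intros)
    moreover have "(\<lambda>p. (fst p, fst (snd p), snd (snd p), w)) ` K \<subseteq> {0..} \<times> UNIV"
      using assms by (auto simp: K_def)
    ultimately have "continuous_on K (\<lambda>p. f (fst p) (fst (snd p)) (snd (snd p), w))"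
      using continuous_on_compose2[OF cont_f] by fastforce
    then show ?thesis unfolding G_def case_prod_beta by (intro continuous_intros)
  qed
  ultimately obtain p where p: "p \<in> K" "\<And>q. q \<in> K \<Longrightarrow> G q \<le> G p"
    using continuous_attains_sup[OF K] by blast
  obtain t y z where pe: "p = (t, y, z)" by (cases p) auto
  have t: "a \<le> t" "t \<le> b" "\<bar>y - x\<bar> \<le> b - t" "\<bar>z - u\<bar> \<le> N * (b - t)" using p pe by (auto simp: K_def)
  have t0: "0 \<le> t" using t assms by simp
  have "0 < f b x (u, w)" using pos nonneg[of b x "(u, w)"] assms by simp
  then have "0 < G (b, x, u)" by (simp add: G_def)
  also have "\<dots> \<le> G p" using p \<open>(b, x, u) \<in> K\<close> by auto
  finally have fp: "0 < f t y (z, w)" by (simp add: G_def pe zero_less_mult_iff)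
  show ?thesis
  proof (cases "t = a")
    case True
    then show ?thesis using t fp by (intro exI[of _ y] exI[of _ z]) auto
  next
    case False
    define P Q where "P = vhat (z, w)" and "Q = E t y"
    \<comment> \<open>The line is straight, with the velocity and the field frozen at the maximum
      point: the equation at this single point already cancels all of the derivative at
      \<open>s = 0\<close> except the contribution of the exponential factor.\<close>
    define h where "h = (\<lambda>s. exp (s - t) * f (t - s) (y - s * P) (z - s * Q, w))"
    have "((\<lambda>s. f (t - s) (y - s * P) (z - s * Q, w)) has_real_derivative
        ft (t - 0) (y - 0 * P) (z - 0 * Q, w) * (-1) + fx (t - 0) (y - 0 * P) (z - 0 * Q, w) * (- P)
        + fu (t - 0) (y - 0 * P) (z - 0 * Q, w) * (- Q) + fw (t - 0) (y - 0 * P) (z - 0 * Q, w) * 0)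
        (at 0 within {0..t})"
      using t0 by (intro deriv_curve) (auto intro!: derivative_eq_intros)
    moreover have "ft t y (z, w) * (-1) + fx t y (z, w) * (- P) + fu t y (z, w) * (- Q) = 0"
      using pde[OF t0, of y "(z, w)"] unfolding P_def Q_def by (simp add: algebra_simps)
    ultimately have "((\<lambda>s. f (t - s) (y - s * P) (z - s * Q, w)) has_real_derivative 0) (at 0 within {0..t})"
      by simp
    then have "(h has_real_derivative exp (0 - t) * f (t - 0) (y - 0 * P) (z - 0 * Q, w)) (at 0 within {0..t})"
      unfolding h_def by (auto intro!: derivative_eq_intros)
    from has_real_derivative_pos_inc_right[OF this] fp obtain e where
      e: "e > 0" "\<And>s. s > 0 \<Longrightarrow> s \<in> {0..t} \<Longrightarrow> s < e \<Longrightarrow> h 0 < h s" by auto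
    define s where "s = min (e / 2) (t - a)"
    have s: "0 < s" "s < e" "s \<le> t - a" "s \<in> {0..t}" using e False t assms by (auto simp: s_def)
    have "\<bar>P\<bar> \<le> 1" "\<bar>Q\<bar> \<le> N" using abs_vhat_less[of "(z, w)"] bnd[of t y] t by (auto simp: P_def Q_def)
    then have "s * \<bar>P\<bar> \<le> s * 1" "s * \<bar>Q\<bar> \<le> s * N" using s by (auto intro!: mult_left_mono)
    then have "\<bar>s * P\<bar> \<le> s" "\<bar>s * Q\<bar> \<le> N * s" using s by (auto simp: abs_mult mult.commute)
    then have "(t - s, y - s * P, z - s * Q) \<in> K"
      using t s by (auto simp: K_def right_diff_distrib)
    from p(2)[OF this] have "h s \<le> h 0" by (simp add: G_def h_def pe)
    with e(2)[of s] s show ?thesis by simp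
  qed
qed

end

subsection \<open>Velocity moments\<close>

lemma supported_in_mono: "supported_in h r \<Longrightarrow> r \<le> s \<Longrightarrow> supported_in h s"
  unfolding supported_in_def by (meson order_less_le_trans)

lemma continuous_on_curry3:
  fixes g :: "real \<Rightarrow> real \<Rightarrow> real \<times> real \<Rightarrow> real"
  assumes "continuous_on ({0..} \<times> UNIV) (\<lambda>(t, x, v). g t x v)"
    and "continuous_on S T" "continuous_on S X" "continuous_on S V" "\<And>p. p \<in> S \<Longrightarrow> 0 \<le> T p"
  shows "continuous_on S (\<lambda>p. g (T p) (X p) (V p))"
  using continuous_on_compose2[OF assms(1), of S "\<lambda>p. (T p, X p, V p)"] assms(2-5)
  by (fastforce intro!: continuous_intros)

context C1_density
begin

lemmas f_continuous [continuous_intros] = continuous_on_curry3[OF cont_f]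
lemmas ft_continuous [continuous_intros] = continuous_on_curry3[OF cont_ft]
lemmas fx_continuous [continuous_intros] = continuous_on_curry3[OF cont_fx]
lemmas fu_continuous [continuous_intros] = continuous_on_curry3[OF cont_fu]

text \<open>The box is fixed, whatever the support of \<open>f t\<close> is. Hence moments can be
  differentiated in time and space before any uniform support is known; they are the full velocity
  moments at times when \<open>supported_in (f t) r\<close> holds.\<close>

definition mom :: "(real \<times> real \<Rightarrow> real) \<Rightarrow> real \<Rightarrow> real \<Rightarrow> real \<Rightarrow> real" where
  "mom \<phi> r t x = integral (cbox (- r, - r) (r, r)) (\<lambda>v. \<phi> v * f t x v)"

definition momt :: "(real \<times> real \<Rightarrow> real) \<Rightarrow> real \<Rightarrow> real \<Rightarrow> real \<Rightarrow> real" where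
  "momt \<phi> r t x = integral (cbox (- r, - r) (r, r)) (\<lambda>v. \<phi> v * ft t x v)"

definition momx :: "(real \<times> real \<Rightarrow> real) \<Rightarrow> real \<Rightarrow> real \<Rightarrow> real \<Rightarrow> real" where
  "momx \<phi> r t x = integral (cbox (- r, - r) (r, r)) (\<lambda>v. \<phi> v * fx t x v)"

lemma mom_deriv_t:
  assumes \<phi>: "continuous_on UNIV \<phi>" and t: "0 \<le> t"
  shows "((\<lambda>s. mom \<phi> r s x) has_real_derivative momt \<phi> r t x) (at t within {0..})"
  unfolding mom_def momt_def has_real_derivative_iff_has_vector_derivative
proof (rule leibniz_rule_vector_derivative[where U = "{0..}"])
  show "((\<lambda>s. \<phi> v * f s x v) has_vector_derivative \<phi> v * ft s x v) (at s within {0..})"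
    if "s \<in> {0..}" for s v
    using that by (auto simp: has_real_derivative_iff_has_vector_derivative[symmetric] intro!: derivative_eq_intros deriv_t)
  show "(\<lambda>v. \<phi> v * f s x v) integrable_on cbox (- r, - r) (r, r)" if "s \<in> {0..}" for s
    using that by (intro integrable_continuous continuous_intros continuous_on_subset[OF \<phi>]) auto
  show "continuous_on ({0..} \<times> cbox (- r, - r) (r, r)) (\<lambda>(s, v). \<phi> v * ft s x v)"
    unfolding case_prod_beta
    by (intro continuous_intros continuous_on_compose2[OF \<phi>]) auto
qed (use t in auto)

lemma mom_deriv_x:
  assumes \<phi>: "continuous_on UNIV \<phi>" and t: "0 \<le> t"
  shows "((\<lambda>y. mom \<phi> r t y) has_real_derivative momx \<phi> r t x) (at x)"
  unfolding mom_def momx_def has_real_derivative_iff_has_vector_derivative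
proof (rule leibniz_rule_vector_derivative[where U = UNIV])
  show "((\<lambda>s. \<phi> v * f t s v) has_vector_derivative \<phi> v * fx t s v) (at s)" for s v
    using t by (auto simp: has_real_derivative_iff_has_vector_derivative[symmetric] intro!: derivative_eq_intros deriv_x)
  show "(\<lambda>v. \<phi> v * f t s v) integrable_on cbox (- r, - r) (r, r)" for s
    using t by (intro integrable_continuous continuous_intros continuous_on_subset[OF \<phi>]) auto
  show "continuous_on (UNIV \<times> cbox (- r, - r) (r, r)) (\<lambda>(s, v). \<phi> v * fx t s v)"
    unfolding case_prod_beta
    using t by (intro continuous_intros continuous_on_compose2[OF \<phi>]) auto
qed auto

lemma mom_cont:
  assumes \<phi>: "continuous_on UNIV \<phi>"
  shows "continuous_on ({0..} \<times> UNIV) (\<lambda>(t, x). mom \<phi> r t x)"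
    and "continuous_on ({0..} \<times> UNIV) (\<lambda>(t, x). momt \<phi> r t x)"
    and "continuous_on ({0..} \<times> UNIV) (\<lambda>(t, x). momx \<phi> r t x)"
  unfolding case_prod_beta mom_def momt_def momx_def
  by (rule integral_continuous_on_param; unfold case_prod_beta;
      intro continuous_intros continuous_on_compose2[OF \<phi>]; auto)+

lemma mom_continuous [continuous_intros]:
  assumes "continuous_on UNIV \<phi>" "continuous_on S T" "continuous_on S X" "\<And>p. p \<in> S \<Longrightarrow> 0 \<le> T p"
  shows "continuous_on S (\<lambda>p. mom \<phi> r (T p) (X p))"
    and "continuous_on S (\<lambda>p. momt \<phi> r (T p) (X p))"
    and "continuous_on S (\<lambda>p. momx \<phi> r (T p) (X p))"
  using continuous_on_compose2[OF mom_cont(1)[OF assms(1)], of S "\<lambda>p. (T p, X p)"]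
    continuous_on_compose2[OF mom_cont(2)[OF assms(1)], of S "\<lambda>p. (T p, X p)"]
    continuous_on_compose2[OF mom_cont(3)[OF assms(1)], of S "\<lambda>p. (T p, X p)"] assms(2-4)
  by (fastforce intro!: continuous_intros)+

lemma mom_zero:
  assumes "supported_in (f t) r" "r \<le> \<bar>x\<bar>"
  shows "mom \<phi> r t x = 0"
proof -
  have "f t x v = 0" for v using assms by (cases v) (force simp: supported_in_def)
  then show ?thesis by (simp add: mom_def)
qed

text \<open>Fubini makes the integration in the first velocity component the inner one; there
  \<open>\<phi> * f\<close> is integrated from face to face, and it vanishes on both faces.\<close>

lemma mom_by_parts:
  assumes t: "0 \<le> t" and S: "supported_in (f t) r" and r: "0 \<le> r"
    and \<phi>: "continuous_on UNIV \<phi>" "continuous_on UNIV \<phi>'"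
      "\<And>u w. ((\<lambda>u. \<phi> (u, w)) has_real_derivative \<phi>' (u, w)) (at u)"
  shows "integral (cbox (- r, - r) (r, r)) (\<lambda>v. \<phi> v * fu t x v) = - mom \<phi>' r t x"
proof -
  let ?B = "cbox (- r, - r) (r, r)"
  let ?g = "\<lambda>v. \<phi> v * fu t x v + \<phi>' v * f t x v"
  have c: "continuous_on T ?g" for T
    using t by (intro continuous_intros continuous_on_subset[OF \<phi>(1)] continuous_on_subset[OF \<phi>(2)]) auto
  have "integral ?B (\<lambda>v. \<phi> v * fu t x v) + mom \<phi>' r t x = integral ?B ?g"
    unfolding mom_def using t
    by (intro integral_add[symmetric] integrable_continuous continuous_intros
        continuous_on_subset[OF \<phi>(1)] continuous_on_subset[OF \<phi>(2)]) auto
  also have "\<dots> = integral (cbox (- r) r) (\<lambda>u. integral (cbox (- r) r) (\<lambda>w. ?g (u, w)))"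
    by (rule integral_prod_continuous[OF c])
  also have "\<dots> = integral (cbox (- r) r) (\<lambda>w. integral (cbox (- r) r) (\<lambda>u. ?g (u, w)))"
    by (rule integral_swap_continuous) (use c in \<open>simp add: case_prod_beta\<close>)
  also have "\<dots> = integral (cbox (- r) r) (\<lambda>w. 0)"
  proof (rule integral_cong)
    fix w
    have "((\<lambda>u. ?g (u, w)) has_integral \<phi> (r, w) * f t x (r, w) - \<phi> (- r, w) * f t x (- r, w)) {- r..r}"
    proof (rule fundamental_theorem_of_calculus)
      fix u
      have "((\<lambda>u. \<phi> (u, w) * f t x (u, w)) has_real_derivative ?g (u, w)) (at u within {- r..r})"
        by (auto intro!: derivative_eq_intros has_field_derivative_at_within[OF \<phi>(3)]
            has_field_derivative_at_within[OF deriv_u[OF t]])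
      then show "((\<lambda>u. \<phi> (u, w) * f t x (u, w)) has_vector_derivative ?g (u, w)) (at u within {- r..r})"
        by (simp add: has_real_derivative_iff_has_vector_derivative)
    qed (use r in auto)
    moreover have "f t x (r, w) = 0" "f t x (- r, w) = 0"
      using S by (force simp: supported_in_def)+
    ultimately show "integral (cbox (- r) r) (\<lambda>u. ?g (u, w)) = 0" by (simp add: integral_unique)
  qed
  finally show ?thesis by simp
qed

end

context vlasov_poisson
begin

text \<open>The Vlasov equation is multiplied by \<open>\<phi>\<close> and integrated in velocity;
  the field does not depend on \<open>v\<close> and leaves the integral. The constant 1 gives
  conservation of charge, \<open>weight\<close> the gain in the functional.\<close>

lemma mom_balance:
  assumes t: "0 \<le> t" and S: "supported_in (f t) r" and r: "0 \<le> r"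
    and \<phi>: "continuous_on UNIV \<phi>" "continuous_on UNIV \<phi>'"
      "\<And>u w. ((\<lambda>u. \<phi> (u, w)) has_real_derivative \<phi>' (u, w)) (at u)"
  shows "momt \<phi> r t x + momx (\<lambda>v. vhat v * \<phi> v) r t x = E t x * mom \<phi>' r t x"
proof -
  let ?B = "cbox (- r, - r) (r, r)"
  note ci = continuous_intros continuous_on_subset[OF \<phi>(1)]
  have "momt \<phi> r t x + momx (\<lambda>v. vhat v * \<phi> v) r t x =
      integral ?B (\<lambda>v. \<phi> v * ft t x v + vhat v * \<phi> v * fx t x v)"
    unfolding momt_def momx_def using t
    by (intro integral_add[symmetric] integrable_continuous ci) auto
  also have "\<dots> = integral ?B (\<lambda>v. - E t x * (\<phi> v * fu t x v))"
  proof (rule integral_cong)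
    fix v
    have "ft t x v = - (vhat v * fx t x v + E t x * fu t x v)" using pde[OF t, of x v] by simp
    then show "\<phi> v * ft t x v + vhat v * \<phi> v * fx t x v = - E t x * (\<phi> v * fu t x v)"
      by (simp only:) (simp add: algebra_simps)
  qed
  also have "\<dots> = E t x * mom \<phi>' r t x"
    using mom_by_parts[OF assms] by simp
  finally show ?thesis .
qed

end

subsection \<open>Conservation of mass\<close>

text \<open>Otherwise each \<open>Z - S n\<close> would be relatively open and dense in
  \<open>Z\<close>, while these sets have empty intersection.\<close>

lemma Baire_countable_closed_cover:
  fixes Z :: "real set"
  assumes "closed Z" "Z \<noteq> {}" "\<And>n::nat. closed (S n)" "Z \<subseteq> (\<Union>n. S n)"
  shows "\<exists>n. \<exists>z\<in>Z. \<exists>e>0. Z \<inter> ball z e \<subseteq> S n"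
proof (rule ccontr)
  assume no: "\<not> ?thesis"
  have "Z \<subseteq> closure (\<Inter>(range (\<lambda>n. Z - S n)))"
  proof (rule Baire[OF \<open>closed Z\<close>])
    fix T assume "T \<in> range (\<lambda>n. Z - S n)"
    then obtain n where T: "T = Z - S n" by auto
    have "openin (top_of_set Z) (Z \<inter> - S n)" using assms(3) by (intro openin_open_Int) auto
    moreover have "Z \<subseteq> closure T"
    proof
      fix z assume z: "z \<in> Z"
      show "z \<in> closure T" unfolding closure_approachable
      proof (intro allI impI)
        fix e :: real assume "0 < e"
        then have "\<not> Z \<inter> ball z e \<subseteq> S n" using no z by blast
        then show "\<exists>y\<in>T. dist y z < e" by (auto simp: T dist_commute)
      qed
    qed
    ultimately show "openin (top_of_set Z) T \<and> Z \<subseteq> closure T" by (simp add: T Diff_eq)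
  qed auto
  moreover have "\<Inter>(range (\<lambda>n. Z - S n)) = {}" using assms(4) by fastforce
  ultimately have "Z \<subseteq> closure {}" by (rule subst[rotated])
  then show False using assms(2) by simp
qed

context vlasov_poisson
begin

lemma rho_eq_mom:
  assumes "0 \<le> t" "supported_in (f t) r"
  shows "\<rho> t x = mom (\<lambda>_. 1) r t x"
proof -
  have "continuous_on UNIV (f t x)" using assms(1) by (intro continuous_intros) auto
  moreover have "f t x v = 0" if "v \<notin> cbox (- r, - r) (r, r)" for v
    using assms(2) that by (cases v) (force simp: supported_in_def cbox_Pair_eq)
  ultimately show ?thesis
    unfolding charge_density_def mom_def using compact_support_lborel(2)[of "f t x" "(- r, - r)" "(r, r)"] by simp
qed

lemma rho_nonneg: "0 \<le> t \<Longrightarrow> 0 \<le> \<rho> t x"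
  unfolding charge_density_def using nonneg by simp

lemma rho_zero: "0 \<le> t \<Longrightarrow> supported_in (f t) r \<Longrightarrow> r \<le> \<bar>x\<bar> \<Longrightarrow> \<rho> t x = 0"
  using rho_eq_mom mom_zero by simp

lemma rho_continuous: "0 \<le> t \<Longrightarrow> continuous_on S (\<rho> t)"
proof -
  assume t: "0 \<le> t"
  obtain r where "supported_in (f t) r" using supp[OF t] by auto
  then have "\<rho> t = mom (\<lambda>_. 1) r t" using rho_eq_mom[OF t] by auto
  then show ?thesis using t by (auto intro!: continuous_intros)
qed

lemma rho_integrable: "0 \<le> t \<Longrightarrow> integrable lborel (\<rho> t)"
proof -
  assume t: "0 \<le> t"
  obtain r where "supported_in (f t) r" using supp[OF t] by auto
  then show ?thesis
    using compact_support_lborel(1)[OF rho_continuous[OF t], of "- r" r] rho_zero[OF t, of r] by force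
qed

lemma mass_eq:
  assumes "0 \<le> t" "supported_in (f t) r"
  shows "mass t = integral {- r..r} (\<rho> t)"
  unfolding mass_def
  using compact_support_lborel(2)[OF rho_continuous[OF assms(1)], of "- r" r] rho_zero[OF assms] by force

lemma mass_nonneg: "0 \<le> t \<Longrightarrow> 0 \<le> mass t"
  unfolding mass_def using rho_nonneg by simp

lemma abs_field_le: "0 \<le> t \<Longrightarrow> \<bar>E t x\<bar> \<le> mass t / 2"
proof -
  assume t: "0 \<le> t"
  have *: "0 \<le> (LINT y:A|lborel. \<rho> t y) \<and> (LINT y:A|lborel. \<rho> t y) \<le> mass t"
    if "A \<in> sets lborel" for A
  proof
    show "0 \<le> (LINT y:A|lborel. \<rho> t y)"
      unfolding set_lebesgue_integral_def using rho_nonneg[OF t] by simp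
    show "(LINT y:A|lborel. \<rho> t y) \<le> mass t"
      unfolding set_lebesgue_integral_def mass_def
      using rho_nonneg[OF t] rho_integrable[OF t] that
      by (intro integral_mono integrable_mult_indicator) (auto simp: indicator_def)
  qed
  show ?thesis using *[of "{..x}"] *[of "{x..}"] by (auto simp: electric_field_def)
qed

text \<open>The charges to the left and to the right of \<open>x\<close> add up to the mass, so the
  left one determines the field. As an integral over a compact interval it can be
  differentiated.\<close>

lemma field_eq:
  assumes t: "0 \<le> t" and S: "supported_in (f t) r" and x: "x \<in> {- r..r}"
  shows "E t x = integral {- r..x} (\<rho> t) - mass t / 2"
proof -
  have z: "\<rho> t y = 0" if "r \<le> \<bar>y\<bar>" for y using rho_zero[OF t S that] .
  have i: "set_integrable lborel {a..b} (\<rho> t)" for a b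
    unfolding set_integrable_def
    by (rule borel_integrable_compact) (auto intro: rho_continuous[OF t])
  have "(LINT y:{..x}|lborel. \<rho> t y) = (LINT y:{- r..x}|lborel. \<rho> t y)"
    unfolding set_lebesgue_integral_def
    by (intro Bochner_Integration.integral_cong) (auto simp: indicator_def z)
  moreover have "(LINT y:{x..}|lborel. \<rho> t y) = (LINT y:{x..r}|lborel. \<rho> t y)"
    unfolding set_lebesgue_integral_def
    by (intro Bochner_Integration.integral_cong) (auto simp: indicator_def z)
  moreover have "integral {- r..x} (\<rho> t) + integral {x..r} (\<rho> t) = mass t"
    unfolding mass_eq[OF t S]
    by (rule Henstock_Kurzweil_Integration.integral_combine)
      (use x in \<open>auto intro: integrable_continuous_real rho_continuous[OF t]\<close>)
  ultimately show ?thesis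
    unfolding electric_field_def set_borel_integral_eq_integral(2)[OF i] by (simp add: field_simps)
qed

text \<open>The balance for the constant 1 has no source, and the current vanishes at
  \<open>- r\<close>; only the flux through \<open>x\<close> is left.\<close>

lemma continuity_equation:
  assumes "0 \<le> a" "a \<le> b" and S: "\<And>t. t \<in> {a..b} \<Longrightarrow> supported_in (f t) r" and r: "0 \<le> r"
    and x: "x \<in> {- r..r}"
  shows "integral {- r..x} (\<rho> b) = integral {- r..x} (\<rho> a) - integral {a..b} (\<lambda>s. mom vhat r s x)"
proof -
  have c1: "continuous_on S (\<lambda>_. 1::real)" for S :: "(real \<times> real) set" by simp
  have "integral {a..b} (\<lambda>t. integral {- r..x} (\<lambda>x. momt (\<lambda>_. 1) r t x + momx vhat r t x)) =
      integral {- r..x} (mom (\<lambda>_. 1) r b) - integral {- r..x} (mom (\<lambda>_. 1) r a)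
      + integral {a..b} (\<lambda>t. mom vhat r t x - mom vhat r t (- r))"
  proof (rule divergence_theorem_rectangle)
    fix t y assume "t \<in> {a..b}" "y \<in> {- r..x}"
    then show "((\<lambda>t. mom (\<lambda>_. 1) r t y) has_vector_derivative momt (\<lambda>_. 1) r t y) (at t within {a..b})"
      using has_field_derivative_subset[OF mom_deriv_t[OF c1, of t r y], of "{a..b}"] assms
      by (auto simp: has_real_derivative_iff_has_vector_derivative)
    show "(mom vhat r t has_vector_derivative momx vhat r t y) (at y within {- r..x})"
      using has_field_derivative_at_within[OF mom_deriv_x[OF continuous_on_vhat, of t r y]] assms \<open>t \<in> {a..b}\<close>
      by (auto simp: has_real_derivative_iff_has_vector_derivative)
  qed (use assms in \<open>auto intro!: continuous_intros integrable_continuous_real simp: case_prod_beta\<close>)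
  moreover have "integral {a..b} (\<lambda>t. integral {- r..x} (\<lambda>x. momt (\<lambda>_. 1) r t x + momx vhat r t x)) =
      integral {a..b} (\<lambda>t. 0)"
  proof (rule Henstock_Kurzweil_Integration.integral_cong)
    fix t assume "t \<in> {a..b}"
    then have "momt (\<lambda>_. 1) r t y + momx vhat r t y = 0" for y
      using mom_balance[of t r "\<lambda>_. 1" "\<lambda>_. 0" y] assms by (simp add: mom_def)
    then show "integral {- r..x} (\<lambda>x. momt (\<lambda>_. 1) r t x + momx vhat r t x) = 0" by simp
  qed
  moreover have "integral {a..b} (\<lambda>t. mom vhat r t x - mom vhat r t (- r)) = integral {a..b} (\<lambda>t. mom vhat r t x)"
    by (rule Henstock_Kurzweil_Integration.integral_cong) (simp add: mom_zero[OF S])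
  moreover have "\<rho> b = mom (\<lambda>_. 1) r b" "\<rho> a = mom (\<lambda>_. 1) r a"
    using rho_eq_mom S assms by auto
  ultimately show ?thesis by simp
qed

text \<open>A bound on the mass bounds the field, so finite propagation puts all supports into one
  box. At the right end of that box the current is zero, and the continuity equation becomes
  conservation of mass.\<close>

lemma mass_constant_if_bounded:
  assumes ab: "0 \<le> a" "a \<le> b" and N: "\<And>t. t \<in> {a..b} \<Longrightarrow> mass t \<le> N"
  shows "\<exists>r>0. \<forall>t\<in>{a..b}. supported_in (f t) r" and "mass b = mass a"
proof -
  obtain ra where ra: "ra > 0" "supported_in (f a) ra" using supp ab by blast
  have N0: "0 \<le> N" using N[of a] mass_nonneg[of a] ab by auto
  \<comment> \<open>Positions spread at speed at most 1, first velocity components at rate at most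
    \<open>N\<close>, second ones not at all; the sum of the rates serves all three.\<close>
  define r where "r = ra + (1 + N) * (b - a)"
  have r: "r > 0" using ra ab N0 by (simp add: r_def add_pos_nonneg)
  have S: "supported_in (f t) r" if t: "t \<in> {a..b}" for t
    unfolding supported_in_def
  proof (intro allI impI)
    fix x u w assume "f t x (u, w) \<noteq> 0"
    moreover have "\<bar>E s y\<bar> \<le> N" if "s \<in> {a..t}" for s y
      using abs_field_le[of s y] N[of s] that t ab N0 by auto
    ultimately obtain y z where yz: "\<bar>y - x\<bar> \<le> t - a" "\<bar>z - u\<bar> \<le> N * (t - a)" "f a y (z, w) \<noteq> 0"
      using finite_propagation[of a t N x u w] ab t by auto
    moreover have "N * (t - a) \<le> N * (b - a)" using N0 t by (intro mult_left_mono) auto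
    moreover have "\<bar>y\<bar> < ra" "\<bar>z\<bar> < ra" "\<bar>w\<bar> < ra" using yz(3) ra(2) by (auto simp: supported_in_def)
    moreover have "0 \<le> N * (b - a)" using N0 ab by simp
    moreover have "r = ra + (b - a) + N * (b - a)" by (simp add: r_def algebra_simps)
    ultimately show "\<bar>x\<bar> < r \<and> \<bar>u\<bar> < r \<and> \<bar>w\<bar> < r" using t ab by auto
  qed
  then show "\<exists>r>0. \<forall>t\<in>{a..b}. supported_in (f t) r" using r by auto
  have "integral {a..b} (\<lambda>s. mom vhat r s r) = integral {a..b} (\<lambda>s. 0)"
    by (rule Henstock_Kurzweil_Integration.integral_cong) (simp add: mom_zero[OF S])
  then have "integral {- r..r} (\<rho> b) = integral {- r..r} (\<rho> a)"
    using continuity_equation[OF ab S, of r] r by simp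
  moreover have "mass a = integral {- r..r} (\<rho> a)" "mass b = integral {- r..r} (\<rho> b)"
    using ab S by (auto intro!: mass_eq)
  ultimately show "mass b = mass a" by simp
qed

text \<open>This is lower semicontinuity of the mass. The charge in a fixed box is continuous in
  time and never exceeds the mass; a box containing the support at the limit time gives equality
  there.\<close>

lemma closed_mass_sublevel: "closed {t. 0 \<le> t \<and> mass t \<le> N}"
  unfolding closed_sequential_limits
proof (intro allI impI, elim conjE)
  fix T l assume T: "\<forall>n::nat. T n \<in> {t. 0 \<le> t \<and> mass t \<le> N}" and lim: "T \<longlonglongrightarrow> l"
  have l: "0 \<le> l" using T by (intro LIMSEQ_le_const[OF lim]) auto
  obtain r where r: "r > 0" "supported_in (f l) r" using supp[OF l] by auto
  define g where "g = (\<lambda>s. integral {- r..r} (mom (\<lambda>_. 1) r s))"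
  have "continuous_on ({0..} \<times> cbox (- r) r) (\<lambda>(t, x). mom (\<lambda>_. 1) r t x)"
    by (rule continuous_on_subset[OF mom_cont(1)]) auto
  then have "continuous_on {0..} (\<lambda>t. integral (cbox (- r) r) (mom (\<lambda>_. 1) r t))"
    by (rule integral_continuous_on_param)
  then have "continuous_on {0..} g"
    by (simp add: g_def)
  then have "(\<lambda>n. g (T n)) \<longlonglongrightarrow> g l"
    by (rule continuous_on_tendsto_compose[OF _ lim]) (use l T in auto)
  moreover have "g s \<le> mass s" if s: "0 \<le> s" for s
  proof -
    obtain q' where "supported_in (f s) q'" using supp[OF s] by auto
    then have q: "supported_in (f s) (max q' r)" by (rule supported_in_mono) auto
    define q where "q = max q' r"
    have le: "mom (\<lambda>_. 1) r s x \<le> \<rho> s x" for x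
      unfolding rho_eq_mom[OF s q] mom_def q_def[symmetric]
      using s by (intro integral_subset_le integrable_continuous continuous_intros)
        (auto simp: cbox_Pair_eq q_def nonneg)
    have "g s \<le> integral {- r..r} (\<rho> s)" unfolding g_def
      using s le by (intro integral_le integrable_continuous_real continuous_intros rho_continuous) auto
    also have "\<dots> \<le> integral {- q..q} (\<rho> s)"
      using s by (intro integral_subset_le integrable_continuous_real rho_continuous) (auto simp: q_def rho_nonneg)
    also have "\<dots> = mass s" using mass_eq[OF s] q by (simp add: q_def)
    finally show ?thesis .
  qed
  then have "g (T n) \<le> N" for n using T order_trans[of "g (T n)" "mass (T n)" N] by simp
  ultimately have "g l \<le> N" by (intro LIMSEQ_le_const2) auto
  moreover have "g l = mass l" unfolding g_def mass_eq[OF l r(2)] rho_eq_mom[OF l r(2)] by simp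
  ultimately show "l \<in> {t. 0 \<le> t \<and> mass t \<le> N}" using l by simp
qed

text \<open>
  Since \<open>mass\<close> is not known to be locally bounded, Baire's theorem is applied to the closed set of
  times near which it is not constant: on some ball the mass is bounded on that set, and the
  components of the complement inherit the bound from an endpoint in the set.
\<close>
lemma mass_locally_constant:
  assumes "0 \<le> t"
  shows "\<exists>e>0. \<forall>s\<ge>0. \<bar>s - t\<bar> < e \<longrightarrow> mass s = mass t"
proof (rule ccontr)
  assume no: "\<not> ?thesis"
  define G where "G = {t. \<exists>e>0. \<forall>s\<ge>0. \<bar>s - t\<bar> < e \<longrightarrow> mass s = mass t}"
  define Z where "Z = {0..} - G"
  have nbhd: "\<exists>e>0. ball s e \<inter> {0..} \<subseteq> G" if "s \<in> G" "0 \<le> s" for s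
  proof -
    have "\<exists>e>0. \<forall>r\<ge>0. \<bar>r - s\<bar> < e \<longrightarrow> mass r = mass s" using that by (simp add: G_def)
    then obtain e where e: "e > 0" "\<And>r. 0 \<le> r \<Longrightarrow> \<bar>r - s\<bar> < e \<Longrightarrow> mass r = mass s" by blast
    have "x \<in> G" if x: "x \<in> ball s (e / 2)" "0 \<le> x" for x
      unfolding G_def
    proof (intro CollectI exI conjI allI impI)
      show "e / 2 > 0" using e by simp
      fix r assume "0 \<le> r" "\<bar>r - x\<bar> < e / 2"
      moreover from this x have "\<bar>r - s\<bar> < e" "\<bar>x - s\<bar> < e" unfolding mem_ball dist_real_def by linarith+
      ultimately show "mass r = mass x" using e(2) x(2) by metis
    qed
    then show ?thesis using e by (intro exI[of _ "e / 2"]) auto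
  qed
  have const: "mass c = mass d" if cd: "{c..d} \<subseteq> {0..}" "{c..d} \<subseteq> G" "c \<le> d" for c d
  proof -
    have "mass constant_on {c..d}"
    proof (rule locally_constant_imp_constant)
      fix x assume x: "x \<in> {c..d}"
      then obtain e where e: "e > 0" "\<And>s. 0 \<le> s \<Longrightarrow> \<bar>s - x\<bar> < e \<Longrightarrow> mass s = mass x"
        using cd(2) by (auto simp: G_def)
      show "\<exists>T. openin (top_of_set {c..d}) T \<and> x \<in> T \<and> (\<forall>y\<in>T. mass y = mass x)"
      proof (intro exI conjI ballI)
        show "openin (top_of_set {c..d}) ({c..d} \<inter> ball x e)" by (intro openin_open_Int) auto
        show "x \<in> {c..d} \<inter> ball x e" using x e by auto
        fix y assume "y \<in> {c..d} \<inter> ball x e"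
        then show "mass y = mass x" using cd(1) by (intro e(2)) (auto simp: dist_real_def)
      qed
    qed simp
    then show ?thesis using cd(3) by (auto simp: constant_on_def)
  qed
  have clZ: "closed Z" unfolding closed_def open_dist
  proof
    fix x assume x: "x \<in> - Z"
    show "\<exists>e>0. \<forall>y. dist y x < e \<longrightarrow> y \<in> - Z"
    proof (cases "0 \<le> x")
      case True
      then have "x \<in> G" using x by (auto simp: Z_def)
      from nbhd[OF this True] obtain e where e: "e > 0" "ball x e \<inter> {0..} \<subseteq> G" by blast
      then have "y \<in> - Z" if "dist y x < e" for y
        using that by (auto simp: Z_def dist_commute subset_iff)
      then show ?thesis using e(1) by blast
    next
      case False
      then show ?thesis by (intro exI[of _ "- x"]) (auto simp: Z_def dist_real_def)
    qed
  qed
  have "Z \<noteq> {}" 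
  proof -
    have "t \<notin> G" using no unfolding G_def mem_Collect_eq .
    then show ?thesis using assms by (auto simp: Z_def)
  qed
  moreover have "Z \<subseteq> (\<Union>n. {t. 0 \<le> t \<and> mass t \<le> real n})"
    using real_arch_simple by (auto simp: Z_def)
  ultimately obtain n z e where z: "z \<in> Z" and e: "e > 0"
    and Zn: "Z \<inter> ball z e \<subseteq> {t. 0 \<le> t \<and> mass t \<le> real n}"
    using Baire_countable_closed_cover[OF clZ _ closed_mass_sublevel] by blast
  have z0: "0 \<le> z" using z by (auto simp: Z_def)
  have bnd: "mass s \<le> real n" if s: "0 \<le> s" "\<bar>s - z\<bar> < e" for s
  proof (cases "s \<in> Z")
    case True
    then show ?thesis using Zn s by (auto simp: dist_real_def)
  next
    case False
    have between: "mass s \<le> real n" if a: "a \<in> Z" "\<bar>a - z\<bar> < e"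
      and G: "\<And>x. x \<in> {min a s..max a s} \<Longrightarrow> x \<noteq> a \<Longrightarrow> x \<in> G" for a
    proof -
      have a0: "0 \<le> a" and an: "mass a \<le> real n" using Zn a by (auto simp: dist_real_def Z_def)
      \<comment> \<open>On the gap between \<open>a\<close> and \<open>s\<close> the mass equals
        \<open>mass s\<close>, and at \<open>a\<close> it is at most \<open>real n\<close>. This
        bound still contains the unknown \<open>mass s\<close>, but it is finite, so conservation
        applies up to and including \<open>a\<close> and carries the bound \<open>real n\<close>
        over to \<open>s\<close>.\<close>
      have "mass x \<le> max (real n) (mass s)" if x: "x \<in> {min a s..max a s}" for x
      proof (cases "x = a")
        case False
        have "mass (min x s) = mass (max x s)"
        proof (rule const)
          show "{min x s..max x s} \<subseteq> {0..}" using x a0 s by auto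
          show "{min x s..max x s} \<subseteq> G" using x False by (intro subsetI G) (auto simp: min_def max_def split: if_splits)
        qed auto
        then show ?thesis by (auto simp: min_def max_def split: if_splits)
      qed (use an in auto)
      then have "mass (max a s) = mass (min a s)"
        using a0 s by (intro mass_constant_if_bounded(2)) auto
      then show ?thesis using an by (auto simp: min_def max_def split: if_splits)
    qed
    show ?thesis
    proof (cases "z \<le> s")
      case True
      define A where "A = Z \<inter> {z..s}"
      have A: "compact A" "A \<noteq> {}" using clZ z True by (auto simp: A_def intro: closed_Int_compact)
      obtain a where a: "a \<in> A" "\<And>x. x \<in> A \<Longrightarrow> x \<le> a" using compact_attains_sup[OF A] by blast
      show ?thesis
      proof (rule between[of a])
        fix x assume x: "x \<in> {min a s..max a s}" "x \<noteq> a"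
        then have "x \<notin> A" "z \<le> x" "x \<le> s" using a by (force simp: A_def)+
        then show "x \<in> G" using z0 by (auto simp: A_def Z_def)
      qed (use a s in \<open>auto simp: A_def\<close>)
    next
      case False
      define A where "A = Z \<inter> {s..z}"
      have A: "compact A" "A \<noteq> {}" using clZ z False by (auto simp: A_def intro: closed_Int_compact)
      obtain a where a: "a \<in> A" "\<And>x. x \<in> A \<Longrightarrow> a \<le> x" using compact_attains_inf[OF A] by blast
      show ?thesis
      proof (rule between[of a])
        fix x assume x: "x \<in> {min a s..max a s}" "x \<noteq> a"
        then have "x \<notin> A" "s \<le> x" "x \<le> z" using a by (force simp: A_def)+
        then show "x \<in> G" using s by (auto simp: A_def Z_def)
      qed (use a s in \<open>auto simp: A_def\<close>)
    qed
  qed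
  have "z \<in> G" unfolding G_def
  proof (intro CollectI exI conjI allI impI)
    show "e > 0" by fact
    fix s assume s: "0 \<le> s" "\<bar>s - z\<bar> < e"
    have "mass (max s z) = mass (min s z)"
      by (rule mass_constant_if_bounded(2)[of _ _ "real n"]) (use s z0 bnd in auto)
    then show "mass s = mass z" by (auto simp: min_def max_def split: if_splits)
  qed
  then show False using z by (simp add: Z_def)
qed

lemma mass_constant: "0 \<le> t \<Longrightarrow> mass t = mass 0"
proof -
  assume t: "0 \<le> t"
  have "mass constant_on {0..}"
  proof (rule locally_constant_imp_constant)
    fix x :: real assume "x \<in> {0..}"
    then obtain e where e: "e > 0" "\<And>s. 0 \<le> s \<Longrightarrow> \<bar>s - x\<bar> < e \<Longrightarrow> mass s = mass x"
      using mass_locally_constant[of x] by auto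
    show "\<exists>T. openin (top_of_set {0..}) T \<and> x \<in> T \<and> (\<forall>y\<in>T. mass y = mass x)"
    proof (intro exI conjI ballI)
      show "openin (top_of_set {0..}) ({0..} \<inter> ball x e)" by (intro openin_open_Int) auto
      show "x \<in> {0..} \<inter> ball x e" using \<open>x \<in> {0..}\<close> e by auto
      fix y assume "y \<in> {0..} \<inter> ball x e"
      then show "mass y = mass x" by (intro e(2)) (auto simp: dist_real_def)
    qed
  qed simp
  then show ?thesis using t by (auto simp: constant_on_def)
qed

subsection \<open>Derivatives of the field\<close>

lemma uniform_support: "0 \<le> T \<Longrightarrow> \<exists>r>0. \<forall>t\<in>{0..T}. supported_in (f t) r"
  by (rule mass_constant_if_bounded(1)[OF order_refl _ eq_refl[OF mass_constant]]) simp_all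

text \<open>Since the mass is constant, the field at \<open>x\<close> changes only by the flux in
  the continuity equation.\<close>

lemma field_deriv_t:
  assumes "\<And>t. t \<in> {0..T} \<Longrightarrow> supported_in (f t) r" "0 \<le> r" "x \<in> {- r..r}" "t \<in> {0..T}"
  shows "((\<lambda>s. E s x) has_real_derivative - mom vhat r t x) (at t within {0..T})"
proof -
  have eq: "E s x = E 0 x - integral {0..s} (\<lambda>s. mom vhat r s x)" if "s \<in> {0..T}" for s
  proof -
    have s: "0 \<le> s" "supported_in (f s) r" "supported_in (f 0) r" using assms(1) that by auto
    have "integral {- r..x} (\<rho> s) = integral {- r..x} (\<rho> 0) - integral {0..s} (\<lambda>s. mom vhat r s x)"
      by (rule continuity_equation) (use assms that in auto)
    then show ?thesis
      using field_eq[OF s(1,2) assms(3)] field_eq[OF order_refl s(3) assms(3)] mass_constant[OF s(1)] by simp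
  qed
  have "((\<lambda>s. E 0 x - integral {0..s} (\<lambda>s. mom vhat r s x)) has_real_derivative 0 - mom vhat r t x)
      (at t within {0..T})"
  proof -
    have "continuous_on {0..T} (\<lambda>s. mom vhat r s x)" by (intro continuous_intros) auto
    from integral_has_vector_derivative[OF this assms(4)] show ?thesis
      by (intro derivative_intros) (simp add: has_real_derivative_iff_has_vector_derivative)
  qed
  from has_field_derivative_transform_within[OF this zero_less_one assms(4) eq[symmetric]]
  show ?thesis by simp
qed

lemma field_deriv_x:
  assumes "0 \<le> t" "supported_in (f t) r" "x \<in> {- r..r}"
  shows "(E t has_real_derivative \<rho> t x) (at x within {- r..r})"
proof -
  have "((\<lambda>y. integral {- r..y} (\<rho> t) - mass t / 2) has_real_derivative \<rho> t x - 0) (at x within {- r..r})"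
    using integral_has_vector_derivative[of "- r" r "\<rho> t" x] assms rho_continuous[OF assms(1)]
    by (intro derivative_intros) (auto simp: has_real_derivative_iff_has_vector_derivative)
  then have "((\<lambda>y. integral {- r..y} (\<rho> t) - mass t / 2) has_real_derivative \<rho> t x) (at x within {- r..r})"
    by simp
  then show ?thesis
    by (rule has_field_derivative_transform_within[OF _ zero_less_one assms(3)])
      (use field_eq[OF assms(1,2)] in auto)
qed

text \<open>The upper limit in the formula for the field moves with \<open>x\<close>. The
  substitution by \<open>\<theta>\<close> in the unit interval moves it into the integrand, where
  continuity of integrals in a parameter applies.\<close>

lemma field_continuous:
  assumes S: "\<And>t. t \<in> {0..T} \<Longrightarrow> supported_in (f t) r" and r: "0 \<le> r"
  shows "continuous_on ({0..T} \<times> {- r..r}) (\<lambda>(t, x). E t x)"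
proof -
  have c: "continuous_on (({0..T} \<times> {- r..r}) \<times> cbox 0 (1::real))
      (\<lambda>(p, \<theta>). (snd p + r) * mom (\<lambda>_. 1) r (fst p) (- r + \<theta> * (snd p + r)))"
    unfolding case_prod_beta by (intro continuous_intros) auto
  have "continuous_on ({0..T} \<times> {- r..r}) (\<lambda>p. integral (cbox 0 (1::real))
      (\<lambda>\<theta>. (snd p + r) * mom (\<lambda>_. 1) r (fst p) (- r + \<theta> * (snd p + r))) - mass 0 / 2)"
    by (intro continuous_intros integral_continuous_on_param[OF c])
  then show ?thesis
  proof (rule continuous_on_eq)
    fix p assume "p \<in> {0..T} \<times> {- r..r}"
    then obtain t x where p: "p = (t, x)" "t \<in> {0..T}" "x \<in> {- r..r}" by auto
    have t: "0 \<le> t" and St: "supported_in (f t) r" using p S by auto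
    have "((\<lambda>\<theta>. (x + r) * mom (\<lambda>_. 1) r t (- r + \<theta> * (x + r))) has_integral
        E t (- r + 1 * (x + r)) - E t (- r + 0 * (x + r))) {0..1}"
    proof (rule fundamental_theorem_of_calculus)
      fix \<theta> :: real assume \<theta>: "\<theta> \<in> {0..1}"
      have im: "- r + s * (x + r) \<in> {- r..r}" if "s \<in> {0..1}" for s
      proof -
        have "0 \<le> s * (x + r)" "s * (x + r) \<le> 1 * (x + r)"
          by (use that p in simp) (rule mult_right_mono, use that p in auto)
        then show ?thesis using p by auto
      qed
      have "(E t has_real_derivative mom (\<lambda>_. 1) r t (- r + \<theta> * (x + r)))
          (at (- r + \<theta> * (x + r)) within (\<lambda>s. - r + s * (x + r)) ` {0..1})"
        by (rule has_field_derivative_subset[OF field_deriv_x[OF t St im[OF \<theta>], unfolded rho_eq_mom[OF t St]]])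
          (use im in auto)
      moreover have "((\<lambda>s. - r + s * (x + r)) has_real_derivative x + r) (at \<theta> within {0..1})"
        by (auto intro!: derivative_eq_intros)
      ultimately have "((\<lambda>s. E t (- r + s * (x + r))) has_real_derivative
          mom (\<lambda>_. 1) r t (- r + \<theta> * (x + r)) * (x + r)) (at \<theta> within {0..1})"
        by (rule DERIV_image_chain[unfolded o_def])
      then show "((\<lambda>s. E t (- r + s * (x + r))) has_vector_derivative
          (x + r) * mom (\<lambda>_. 1) r t (- r + \<theta> * (x + r))) (at \<theta> within {0..1})"
        by (simp add: has_real_derivative_iff_has_vector_derivative mult.commute)
    qed simp
    moreover have "E t (- r) = - mass 0 / 2"
      using field_eq[OF t St, of "- r"] mass_constant[OF t] r by simp
    ultimately have "((\<lambda>\<theta>. (x + r) * mom (\<lambda>_. 1) r t (- r + \<theta> * (x + r))) has_integral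
        E t x + mass 0 / 2) {0..1}" by simp
    from integral_unique[OF this] show "integral (cbox 0 (1::real))
        (\<lambda>\<theta>. (snd p + r) * mom (\<lambda>_. 1) r (fst p) (- r + \<theta> * (snd p + r))) - mass 0 / 2 =
        (case p of (t, x) \<Rightarrow> E t x)"
      by (simp add: p)
  qed
qed

end

subsection \<open>The monotone functional\<close>

lemma sqrt_one_plus_square_pos: "0 < sqrt (1 + (x::real)\<^sup>2)"
  by (simp add: add_pos_nonneg)

definition weight :: "real \<times> real \<Rightarrow> real" where
  "weight v = (fst v - energy v) / sqrt (1 + (snd v)\<^sup>2)"

definition weight' :: "real \<times> real \<Rightarrow> real" where
  "weight' v = (1 - vhat v) / sqrt (1 + (snd v)\<^sup>2)"

text \<open>The divisor in \<open>weight\<close> is the geometric mean of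
  \<open>energy v - fst v\<close> and \<open>energy v + fst v\<close>, whose product is 1 + v2^2.
  The quotient is therefore a function of their ratio, that is, of \<open>vhat v\<close>.\<close>

lemma weight_eq_vhat: "weight v = - sqrt ((1 - vhat v) / (1 + vhat v))"
proof -
  define p q where "p = energy v - fst v" and "q = energy v + fst v"
  have pq: "0 < p" "0 < q" using energy_gt[of v] by (auto simp: p_def q_def)
  have "p * q = (energy v)\<^sup>2 - (fst v)\<^sup>2" by (simp add: p_def q_def power2_eq_square algebra_simps)
  also have "\<dots> = 1 + (snd v)\<^sup>2" by (simp add: energy_def)
  finally have "weight v = - (p / sqrt (p * q))" by (simp add: weight_def p_def minus_divide_left)
  also have "p / sqrt (p * q) = sqrt p / sqrt q"
    using pq real_div_sqrt[of p] by (simp add: real_sqrt_mult field_simps)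
  also have "\<dots> = sqrt (p / q)" by (simp add: real_sqrt_divide)
  also have "p / q = (1 - vhat v) / (1 + vhat v)"
  proof -
    have "1 - vhat v = p / energy v" "1 + vhat v = q / energy v"
      using energy_pos[of v] by (simp_all add: p_def q_def vhat_def field_simps)
    then show ?thesis using energy_pos[of v] by simp
  qed
  finally show ?thesis .
qed

lemma weight_nonpos: "weight v \<le> 0"
  using abs_vhat_less[of v] by (simp add: weight_eq_vhat)

lemma weight_mono:
  assumes "vhat v \<le> vhat v'"
  shows "weight v \<le> weight v'"
proof -
  have "(1 - vhat v') / (1 + vhat v') \<le> (1 - vhat v) / (1 + vhat v)"
    using assms abs_vhat_less[of v] abs_vhat_less[of v'] by (intro frac_le) auto
  then show ?thesis by (simp add: weight_eq_vhat)
qed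

lemma vhat_weight_monotone: "0 \<le> (vhat v - vhat v') * (weight v - weight v')"
  using weight_mono[of v v'] weight_mono[of v' v]
  by (cases "vhat v \<le> vhat v'") (auto intro: mult_nonneg_nonneg mult_nonpos_nonpos)

text \<open>The energy is at most 1 + |v1| + |v2| and the divisor at least 1. This crude bound
  controls the functional from below at time 0.\<close>

lemma weight_ge: "- (1 + \<bar>snd v\<bar> + 2 * \<bar>fst v\<bar>) \<le> weight v"
proof -
  have "(energy v)\<^sup>2 \<le> (1 + \<bar>snd v\<bar> + \<bar>fst v\<bar>)\<^sup>2"
    by (simp add: energy_def power2_eq_square algebra_simps abs_mult_self_eq)
  then have "energy v \<le> 1 + \<bar>snd v\<bar> + \<bar>fst v\<bar>" by (rule power2_le_imp_le) auto
  moreover have "(energy v - fst v) / sqrt (1 + (snd v)\<^sup>2) \<le> (energy v - fst v) / 1"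
    using energy_gt[of v] sqrt_one_plus_square_pos[of "snd v"] by (intro divide_left_mono) auto
  moreover have "weight v = - ((energy v - fst v) / sqrt (1 + (snd v)\<^sup>2))"
    by (simp add: weight_def minus_divide_left)
  ultimately show ?thesis by auto
qed

lemma DERIV_weight: "((\<lambda>u. weight (u, w)) has_real_derivative weight' (u, w)) (at u)"
proof -
  have "((\<lambda>u. energy (u, w)) has_real_derivative vhat (u, w)) (at u)"
  proof -
    have "0 < 1 + u\<^sup>2 + w\<^sup>2" by (smt (verit) zero_le_power2)
    then show ?thesis unfolding energy_def vhat_def fst_conv snd_conv
      by (auto intro!: derivative_eq_intros simp: field_simps)
  qed
  from DERIV_cdivide[OF DERIV_diff[OF DERIV_ident this], of "sqrt (1 + w\<^sup>2)"]
  show ?thesis unfolding weight_def weight'_def fst_conv snd_conv .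
qed

lemma continuous_on_weight [continuous_intros]: "continuous_on S weight"
  unfolding weight_def
  using sqrt_one_plus_square_pos by (intro continuous_intros) (auto simp: less_imp_neq[symmetric])

lemma continuous_on_weight' [continuous_intros]: "continuous_on S weight'"
  unfolding weight'_def
  using sqrt_one_plus_square_pos by (intro continuous_intros) (auto simp: less_imp_neq[symmetric])

context vlasov_poisson
begin

lemma mom_has_integral:
  "0 \<le> t \<Longrightarrow> continuous_on UNIV \<phi> \<Longrightarrow>
    ((\<lambda>v. \<phi> v * f t x v) has_integral mom \<phi> r t x) (cbox (- r, - r) (r, r))"
  unfolding mom_def
  by (intro integrable_integral integrable_continuous continuous_intros)
    (auto intro: continuous_on_subset)

lemma mom_mono:
  assumes "0 \<le> t" "continuous_on UNIV \<phi>" "continuous_on UNIV \<psi>"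
    and "\<And>v. f t x v \<noteq> 0 \<Longrightarrow> \<phi> v \<le> \<psi> v"
  shows "mom \<phi> r t x \<le> mom \<psi> r t x"
proof (rule has_integral_le[OF mom_has_integral mom_has_integral])
  fix v show "\<phi> v * f t x v \<le> \<psi> v * f t x v"
    using assms(4)[of v] nonneg[OF assms(1), of x v] by (cases "f t x v = 0") (auto intro: mult_right_mono)
qed (use assms in auto)

lemma mom_scale: "mom (\<lambda>v. a * \<phi> v) r t x = a * mom \<phi> r t x"
  unfolding mom_def by (simp add: mult.assoc)

text \<open>
  Chebyshev's inequality: \<open>(vhat v - vhat v') * (weight v - weight v')\<close> is integrated against
  \<open>f\<close> first in \<open>v\<close> and then in \<open>v'\<close>.
\<close>
lemma mom_Chebyshev:
  assumes t: "0 \<le> t"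
  shows "mom vhat r t x * mom weight r t x \<le> mom (\<lambda>_. 1) r t x * mom (\<lambda>v. vhat v * weight v) r t x"
proof -
  let ?B = "cbox (- r, - r) (r, r)"
  define \<rho>' j w k where "\<rho>' = mom (\<lambda>_. 1) r t x" and "j = mom vhat r t x"
    and "w = mom weight r t x" and "k = mom (\<lambda>v. vhat v * weight v) r t x"
  have H: "((\<lambda>v. 1 * f t x v) has_integral \<rho>') ?B" "((\<lambda>v. vhat v * f t x v) has_integral j) ?B"
    "((\<lambda>v. weight v * f t x v) has_integral w) ?B" "((\<lambda>v. vhat v * weight v * f t x v) has_integral k) ?B"
    unfolding \<rho>'_def j_def w_def k_def by (intro mom_has_integral t continuous_intros)+
  have 1: "0 \<le> k - vhat v' * w - weight v' * j + vhat v' * weight v' * \<rho>'" for v'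
  proof (rule has_integral_nonneg)
    show "((\<lambda>v. vhat v * weight v * f t x v - vhat v' * (weight v * f t x v) - weight v' * (vhat v * f t x v)
        + vhat v' * weight v' * (1 * f t x v)) has_integral
        k - vhat v' * w - weight v' * j + vhat v' * weight v' * \<rho>') ?B"
      by (intro has_integral_add has_integral_diff has_integral_mult_right H)
    fix v
    have "0 \<le> (vhat v - vhat v') * (weight v - weight v') * f t x v"
      by (rule mult_nonneg_nonneg[OF vhat_weight_monotone nonneg[OF t]])
    then show "0 \<le> vhat v * weight v * f t x v - vhat v' * (weight v * f t x v) - weight v' * (vhat v * f t x v)
        + vhat v' * weight v' * (1 * f t x v)" by (simp add: algebra_simps)
  qed
  have "0 \<le> k * \<rho>' - w * j - j * w + \<rho>' * k"
  proof (rule has_integral_nonneg)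
    show "((\<lambda>v. k * (1 * f t x v) - w * (vhat v * f t x v) - j * (weight v * f t x v)
        + \<rho>' * (vhat v * weight v * f t x v)) has_integral k * \<rho>' - w * j - j * w + \<rho>' * k) ?B"
      by (intro has_integral_add has_integral_diff has_integral_mult_right H)
    fix v
    have "0 \<le> (k - vhat v * w - weight v * j + vhat v * weight v * \<rho>') * f t x v"
      using 1[of v] nonneg[OF t] by (intro mult_nonneg_nonneg) auto
    then show "0 \<le> k * (1 * f t x v) - w * (vhat v * f t x v) - j * (weight v * f t x v)
        + \<rho>' * (vhat v * weight v * f t x v)" by (simp add: algebra_simps)
  qed
  then show ?thesis unfolding \<rho>'_def[symmetric] j_def[symmetric] w_def[symmetric] k_def[symmetric]
    by (simp add: algebra_simps)
qed

text \<open>Speeds are at most 1 and \<open>w\<close> is constant along trajectories, so neither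
  bound depends on the size of the field. The first closes the window on the right, the second
  bounds the divisor in \<open>weight'\<close>.\<close>

lemma support_forward:
  assumes t: "0 \<le> t" and S: "supported_in (f 0) r" and "f t x (u, w) \<noteq> 0"
  shows "x < r + t" "\<bar>w\<bar> < r"
proof -
  have "\<bar>E s y\<bar> \<le> mass 0" if "s \<in> {0..t}" for s y
    using abs_field_le[of s y] mass_constant[of s] mass_nonneg[of s] that by auto
  from finite_propagation[OF order_refl t this assms(3)]
  obtain y z where "\<bar>y - x\<bar> \<le> t" "f 0 y (z, w) \<noteq> 0" by auto
  then show "x < r + t" "\<bar>w\<bar> < r" using S by (force simp: supported_in_def)+
qed

text \<open>The threshold lies strictly between 0 and the greatest field value
  \<open>mass 0 / 2\<close>: the field is bounded away from zero where the cutoff is positive, and a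
  fixed amount of charge lies there. The square makes the cutoff continuously
  differentiable.\<close>

definition cutoff :: "real \<Rightarrow> real" where
  "cutoff e = (max 0 (e - mass 0 / 4))\<^sup>2"

definition cutoff' :: "real \<Rightarrow> real" where
  "cutoff' e = 2 * max 0 (e - mass 0 / 4)"

lemma DERIV_cutoff: "(cutoff has_real_derivative cutoff' e) (at e)"
  using DERIV_max_zero_power[of "mass 0 / 4" 0 e]
  unfolding cutoff_def cutoff'_def by (simp add: power2_eq_square)

lemma cutoff_bounds: "0 \<le> cutoff e" "0 \<le> cutoff' e" "e \<le> mass 0 / 2 \<Longrightarrow> cutoff e \<le> (mass 0 / 4)\<^sup>2"
  unfolding cutoff_def cutoff'_def using mass_nonneg[of 0] by (auto intro!: power_mono simp: max_def)

lemma continuous_on_cutoff: "continuous_on S cutoff" "continuous_on S cutoff'"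
  unfolding cutoff_def cutoff'_def by (intro continuous_intros)+

text \<open>The density is the space derivative of the field, so the integrand is the derivative of
  \<open>P (E t x)\<close>, and the field runs from \<open>- mass 0 / 2\<close> to
  \<open>mass 0 / 2\<close>.\<close>

lemma integral_cutoff_density:
  assumes t: "0 \<le> t" and S: "supported_in (f t) r" and r: "0 < r"
  shows "integral {- r..r} (\<lambda>x. cutoff (E t x) * \<rho> t x) = (mass 0 / 4) ^ 3 / 3"
proof -
  define P where "P = (\<lambda>e. (max 0 (e - mass 0 / 4)) ^ 3 / 3)"
  have P: "(P has_real_derivative cutoff e) (at e)" for e
    using DERIV_cdivide[OF DERIV_max_zero_power[of "mass 0 / 4" 1 e], of 3]
    unfolding P_def cutoff_def by (simp add: numeral_3_eq_3 numeral_2_eq_2)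
  have "((\<lambda>x. cutoff (E t x) * \<rho> t x) has_integral P (E t r) - P (E t (- r))) {- r..r}"
  proof (rule fundamental_theorem_of_calculus)
    fix x assume "x \<in> {- r..r}"
    from DERIV_chain2[OF P field_deriv_x[OF t S this]]
    show "((\<lambda>x. P (E t x)) has_vector_derivative cutoff (E t x) * \<rho> t x) (at x within {- r..r})"
      by (simp add: has_real_derivative_iff_has_vector_derivative)
  qed (use r in auto)
  moreover have "E t r = mass 0 / 2" "E t (- r) = - mass 0 / 2"
    using field_eq[OF t S, of r] field_eq[OF t S, of "- r"] mass_constant[OF t] mass_eq[OF t S] r by auto
  ultimately show ?thesis using mass_nonneg[of 0] by (simp add: integral_unique P_def)
qed

text \<open>The flux \<open>F\<close> belonging to \<open>A\<close> carries an additional factor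
  \<open>vhat\<close> in each moment and vanishes at both ends. The divergence theorem reduces the
  claim to the sign of \<open>At t x + Fx t x\<close>.\<close>

lemma functional_monotone:
  assumes T: "0 \<le> T" and S: "\<And>t. t \<in> {0..T} \<Longrightarrow> supported_in (f t) r" and r: "0 < r"
    and S0: "supported_in (f 0) r0" and c: "c = mass 0 / 4 / sqrt (1 + r0\<^sup>2)"
    and A: "A = (\<lambda>t x. cutoff (E t x) * (c * (x - t) * mom (\<lambda>_. 1) r t x + mom weight r t x))"
  shows "integral {- r..r} (A 0) \<le> integral {- r..r} (A T)"
proof -
  define F where "F = (\<lambda>t x. cutoff (E t x) *
    (c * (x - t) * mom vhat r t x + mom (\<lambda>v. vhat v * weight v) r t x))"
  define At where "At = (\<lambda>t x. cutoff' (E t x) * (- mom vhat r t x) *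
      (c * (x - t) * mom (\<lambda>_. 1) r t x + mom weight r t x) +
    cutoff (E t x) * (- c * mom (\<lambda>_. 1) r t x + c * (x - t) * momt (\<lambda>_. 1) r t x + momt weight r t x))"
  define Fx where "Fx = (\<lambda>t x. cutoff' (E t x) * mom (\<lambda>_. 1) r t x *
      (c * (x - t) * mom vhat r t x + mom (\<lambda>v. vhat v * weight v) r t x) +
    cutoff (E t x) * (c * mom vhat r t x + c * (x - t) * momx vhat r t x +
      momx (\<lambda>v. vhat v * weight v) r t x))"
  let ?R = "{0..T} \<times> {- r..r}"
  have c1: "continuous_on B (\<lambda>_. 1::real)" for B :: "(real \<times> real) set" by simp
  have cvw: "continuous_on B (\<lambda>v. vhat v * weight v)" for B by (intro continuous_intros)
  have cE: "continuous_on ?R (\<lambda>p. E (fst p) (snd p))"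
    using field_continuous[OF S] r by (simp add: case_prod_beta)
  note cs = continuous_intros mom_continuous[OF cvw] continuous_on_compose2[OF continuous_on_cutoff(1)]
    continuous_on_compose2[OF continuous_on_cutoff(2)] cE
  have dt: "((\<lambda>t. A t x) has_vector_derivative At t x) (at t within {0..T})"
    if t: "t \<in> {0..T}" and x: "x \<in> {- r..r}" for t x
  proof -
    have t0: "0 \<le> t" using t by auto
    have m: "((\<lambda>s. mom \<phi> r s x) has_real_derivative momt \<phi> r t x) (at t within {0..T})"
      if "continuous_on UNIV \<phi>" for \<phi>
      by (rule has_field_derivative_subset[OF mom_deriv_t[OF that t0]]) auto
    have "((\<lambda>s. E s x) has_real_derivative - mom vhat r t x) (at t within {0..T})"
      by (rule field_deriv_t[OF S _ x t]) (use r in auto)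
    from DERIV_chain2[OF DERIV_cutoff this]
    have "((\<lambda>t. A t x) has_real_derivative At t x) (at t within {0..T})"
      unfolding A At_def
      by (auto intro!: derivative_eq_intros m c1 continuous_intros simp: algebra_simps)
    then show ?thesis by (simp add: has_real_derivative_iff_has_vector_derivative)
  qed
  have dx: "((\<lambda>x. F t x) has_vector_derivative Fx t x) (at x within {- r..r})"
    if t: "t \<in> {0..T}" and x: "x \<in> {- r..r}" for t x
  proof -
    have t0: "0 \<le> t" using t by auto
    have m: "((\<lambda>y. mom \<phi> r t y) has_real_derivative momx \<phi> r t x) (at x within {- r..r})"
      if "continuous_on UNIV \<phi>" for \<phi>
      by (rule has_field_derivative_at_within[OF mom_deriv_x[OF that t0]])
    have "(E t has_real_derivative mom (\<lambda>_. 1) r t x) (at x within {- r..r})"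
      using field_deriv_x[OF t0 S[OF t] x] by (simp add: rho_eq_mom[OF t0 S[OF t]])
    from DERIV_chain2[OF DERIV_cutoff this]
    have "((\<lambda>x. F t x) has_real_derivative Fx t x) (at x within {- r..r})"
      unfolding F_def Fx_def
      by (auto intro!: derivative_eq_intros m cvw continuous_intros simp: algebra_simps)
    then show ?thesis by (simp add: has_real_derivative_iff_has_vector_derivative)
  qed
  have cAt: "continuous_on ?R (\<lambda>(t, x). At t x)"
    unfolding At_def case_prod_beta by (intro cs) auto
  have cFx: "continuous_on ?R (\<lambda>(t, x). Fx t x)"
    unfolding Fx_def case_prod_beta by (intro cs) auto
  have cA: "A t integrable_on {- r..r}" if t: "t \<in> {0..T}" for t
  proof -
    have "continuous_on {- r..r} (E t)"
      using field_deriv_x[of t r] S[OF t] t by (intro DERIV_continuous_on) auto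
    then show ?thesis unfolding A using t
      by (intro integrable_continuous_real continuous_intros continuous_on_compose2[OF continuous_on_cutoff(1)]) auto
  qed
  have nonneg': "0 \<le> At t x + Fx t x" if t: "t \<in> {0..T}" for t x
  proof -
    have t0: "0 \<le> t" using t by auto
    note St = S[OF t]
    define R j w k s where "R = mom (\<lambda>_. 1) r t x" and "j = mom vhat r t x"
      and "w = mom weight r t x" and "k = mom (\<lambda>v. vhat v * weight v) r t x"
      and "s = mom weight' r t x"
    have mass_b: "momt (\<lambda>_. 1) r t x + momx vhat r t x = 0"
      using mom_balance[OF t0 St, of "\<lambda>_. 1" "\<lambda>_. 0" x] r by (simp add: mom_def)
    have weight_b: "momt weight r t x + momx (\<lambda>v. vhat v * weight v) r t x = E t x * s"
      using mom_balance[OF t0 St _ _ _ DERIV_weight, of x] r by (simp add: s_def continuous_intros)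
    \<comment> \<open>The field has time derivative \<open>- j\<close> and space derivative
      \<open>R\<close>, so in the two terms with \<open>cutoff'\<close> the summands containing
      \<open>c * (x - t)\<close> cancel. The loss \<open>c * (R - j)\<close> stems from
      differentiating \<open>x - t\<close>.\<close>
    have "At t x + Fx t x = cutoff' (E t x) * (R * k - j * w) +
        cutoff (E t x) * (c * (x - t) * (momt (\<lambda>_. 1) r t x + momx vhat r t x) - c * (R - j) +
          (momt weight r t x + momx (\<lambda>v. vhat v * weight v) r t x))"
      unfolding At_def Fx_def R_def j_def w_def k_def by (simp add: algebra_simps)
    also have "\<dots> = cutoff' (E t x) * (R * k - j * w) + cutoff (E t x) * (E t x * s - c * (R - j))"
      by (simp add: mass_b weight_b)
    finally have eq: "At t x + Fx t x = \<dots>" .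
    have Ch: "0 \<le> R * k - j * w"
      using mom_Chebyshev[OF t0, of r x] by (simp add: R_def j_def w_def k_def)
    have jR: "j \<le> R" unfolding j_def R_def
      using abs_vhat_less by (intro mom_mono t0 continuous_intros) (auto simp: abs_less_iff less_imp_le)
    have "1 / sqrt (1 + r0\<^sup>2) * (R - j) = mom (\<lambda>v. 1 / sqrt (1 + r0\<^sup>2) * (1 - vhat v)) r t x"
    proof -
      have "R - j = mom (\<lambda>v. 1 - vhat v) r t x"
      proof (rule has_integral_unique)
        have "((\<lambda>v. 1 * f t x v - vhat v * f t x v) has_integral R - j) (cbox (- r, - r) (r, r))"
          unfolding R_def j_def by (intro has_integral_diff mom_has_integral t0 continuous_intros)
        then show "((\<lambda>v. (1 - vhat v) * f t x v) has_integral R - j) (cbox (- r, - r) (r, r))"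
          by (simp add: left_diff_distrib)
        show "((\<lambda>v. (1 - vhat v) * f t x v) has_integral mom (\<lambda>v. 1 - vhat v) r t x) (cbox (- r, - r) (r, r))"
          by (intro mom_has_integral t0 continuous_intros)
      qed
      then show ?thesis by (simp only: mom_scale)
    qed
    also have "\<dots> \<le> s" unfolding s_def
    proof (intro mom_mono t0 continuous_intros)
      fix v assume v: "f t x v \<noteq> 0"
      obtain u w where uw: "v = (u, w)" by (cases v)
      have "\<bar>w\<bar> \<le> \<bar>r0\<bar>" using support_forward(2)[OF t0 S0] v uw by fastforce
      then have "sqrt (1 + w\<^sup>2) \<le> sqrt (1 + r0\<^sup>2)" by (simp add: abs_le_square_iff)
      then have "1 / sqrt (1 + r0\<^sup>2) \<le> 1 / sqrt (1 + w\<^sup>2)"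
        using sqrt_one_plus_square_pos by (intro divide_left_mono) auto
      then have "1 / sqrt (1 + r0\<^sup>2) * (1 - vhat v) \<le> 1 / sqrt (1 + w\<^sup>2) * (1 - vhat v)"
        using abs_vhat_less[of v] by (intro mult_right_mono) auto
      then show "1 / sqrt (1 + r0\<^sup>2) * (1 - vhat v) \<le> weight' v" by (simp add: weight'_def uw)
    qed
    finally have s: "1 / sqrt (1 + r0\<^sup>2) * (R - j) \<le> s" .
    \<comment> \<open>Here the value of \<open>c\<close> enters: it is the field threshold times the
      least value of 1 / sqrt(1 + w^2) for |w| at most \<open>r0\<close>. Below the threshold the
      cutoff is zero.\<close>
    have "0 \<le> cutoff (E t x) * (E t x * s - c * (R - j))"
    proof (cases "mass 0 / 4 \<le> E t x")
      case True
      have "0 \<le> 1 / sqrt (1 + r0\<^sup>2) * (R - j)" using jR by (intro mult_nonneg_nonneg) auto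
      with s have s0: "0 \<le> s" by linarith
      have "c * (R - j) = mass 0 / 4 * (1 / sqrt (1 + r0\<^sup>2) * (R - j))" by (simp add: c)
      also have "\<dots> \<le> mass 0 / 4 * s" using s mass_nonneg[of 0] by (intro mult_left_mono) auto
      also have "\<dots> \<le> E t x * s" using True s0 by (intro mult_right_mono) auto
      finally show ?thesis using cutoff_bounds(1) by (intro mult_nonneg_nonneg) auto
    next
      case False
      then show ?thesis by (simp add: cutoff_def)
    qed
    moreover have "0 \<le> cutoff' (E t x) * (R * k - j * w)"
      using Ch cutoff_bounds(2) by (intro mult_nonneg_nonneg) auto
    ultimately show ?thesis by (simp add: eq)
  qed
  have "0 \<le> integral {0..T} (\<lambda>t. integral {- r..r} (\<lambda>x. At t x + Fx t x))"
  proof -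
    have "continuous_on ({0..T} \<times> cbox (- r) r) (\<lambda>(t, x). At t x + Fx t x)"
      using continuous_on_add[OF cAt cFx] by (simp add: case_prod_beta)
    then have ct: "continuous_on {0..T} (\<lambda>t. integral (cbox (- r) r) (\<lambda>x. At t x + Fx t x))"
      and cx: "continuous_on ({0..T} \<times> {- r..r}) (\<lambda>(t, x). At t x + Fx t x)"
      using integral_continuous_on_param[of "{0..T}" "- r" r "\<lambda>t x. At t x + Fx t x"] by auto
    have "(\<lambda>x. At t x + Fx t x) integrable_on {- r..r}" if "t \<in> {0..T}" for t
    proof -
      have "Pair t ` {- r..r} \<subseteq> {0..T} \<times> {- r..r}" "continuous_on {- r..r} (Pair t)"
        using that by (auto intro!: continuous_intros)
      from continuous_on_compose2[OF cx this(2,1)] show ?thesis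
        by (intro integrable_continuous_real) simp
    qed
    then have inner: "0 \<le> integral {- r..r} (\<lambda>x. At t x + Fx t x)" if "t \<in> {0..T}" for t
      using nonneg' that by (intro Henstock_Kurzweil_Integration.integral_nonneg) auto
    show ?thesis
      by (rule Henstock_Kurzweil_Integration.integral_nonneg[OF integrable_continuous_real inner])
        (use ct in simp_all)
  qed
  also have "\<dots> = integral {- r..r} (A T) - integral {- r..r} (A 0) + integral {0..T} (\<lambda>t. F t r - F t (- r))"
    by (rule divergence_theorem_rectangle[OF T _ dt dx cAt cFx cA cA]) (use r T in auto)
  also have "integral {0..T} (\<lambda>t. F t r - F t (- r)) = integral {0..T} (\<lambda>t. 0)"
    by (rule Henstock_Kurzweil_Integration.integral_cong) (simp add: F_def mom_zero[OF S])
  finally show ?thesis by simp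
qed

section \<open>Charge in a moving window and the lower bound of the norms\<close>

text \<open>A continuous nonnegative function with integral zero vanishes; this is applied to the
  density in space and then to \<open>f 0 x0\<close> in velocity.\<close>

lemma mass_pos:
  assumes "f 0 x0 v0 \<noteq> 0"
  shows "0 < mass 0"
proof (rule ccontr)
  assume "\<not> 0 < mass 0"
  then have m: "mass 0 = 0" using mass_nonneg[of 0] by simp
  obtain r where r: "0 < r" and S: "supported_in (f 0) r" using supp[of 0] by auto
  have x0: "x0 \<in> cbox (- r) r" and v0: "v0 \<in> cbox (- r, - r) (r, r)"
    using S assms by (cases v0; force simp: supported_in_def cbox_Pair_eq)+
  have "(\<rho> 0 has_integral 0) (cbox (- r) r)"
    using m integrable_integral[OF integrable_continuous_real[OF rho_continuous[of 0 "{- r..r}"]]]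
    by (simp add: mass_eq[OF order_refl S])
  from has_integral_0_cbox_imp_0[OF rho_continuous[OF order_refl] rho_nonneg[OF order_refl] this _ x0] r
  have "\<rho> 0 x0 = 0" by simp
  then have "mom (\<lambda>_. 1) r 0 x0 = 0" using rho_eq_mom[OF order_refl S] by simp
  then have "(f 0 x0 has_integral 0) (cbox (- r, - r) (r, r))"
    using mom_has_integral[of 0 "\<lambda>_. 1" x0 r] by simp
  moreover have "continuous_on (cbox (- r, - r) (r, r)) (f 0 x0)" by (intro continuous_intros) auto
  moreover have "(0, 0) \<in> box (- r, - r) (r, r)" using r by (auto simp: mem_box Basis_prod_def)
  ultimately have "f 0 x0 v0 = 0"
    using has_integral_0_cbox_imp_0[of "(- r, - r)" "(r, r)" "f 0 x0" v0] nonneg[of 0] v0 by auto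
  with assms show False by simp
qed

text \<open>The functional stays above \<open>- K\<close>. If all the charge counted by the cutoff,
  whose weighted total is always \<open>X\<close>, lay behind \<open>t - L\<close>, it would push
  the functional below \<open>- c * L * X\<close>, which is too low for large
  \<open>L\<close>.\<close>

lemma density_in_moving_window:
  assumes M: "0 < mass 0"
  shows "\<exists>\<delta>>0. \<exists>L R. 1 \<le> L + R \<and> (\<forall>t\<ge>0. \<delta> \<le> integral {t - L..t + R} (\<rho> t))"
proof -
  obtain r0 where r0: "0 < r0" and S0: "supported_in (f 0) r0" using supp[of 0] by auto
  define c where "c = mass 0 / 4 / sqrt (1 + r0\<^sup>2)"
  have c0: "0 < c" using M sqrt_one_plus_square_pos by (simp add: c_def)
  define Q where "Q = (mass 0 / 4)\<^sup>2"
  have Q0: "0 < Q" using M by (simp add: Q_def)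
  \<comment> \<open>At time 0 the support gives \<open>x\<close> at least \<open>- r0\<close> and
    \<open>weight\<close> at least \<open>- (1 + 3 * r0)\<close>; so \<open>- K\<close> is a lower
    bound for the initial functional.\<close>
  define B where "B = c * r0 + (1 + 3 * r0)"
  have B0: "0 \<le> B" using c0 r0 by (simp add: B_def)
  define K where "K = Q * B * mass 0"
  have K0: "0 \<le> K" using Q0 B0 M by (simp add: K_def)
  define X where "X = (mass 0 / 4) ^ 3 / 3"
  have X0: "0 < X" using M by (simp add: X_def)
  \<comment> \<open>The quotient leaves a surplus of 1 in \<open>LX\<close>; the added 1 makes the
    window long enough for \<open>Lp_norm_ge_average\<close>.\<close>
  define L where "L = (K + 1) / (c * X) + 1"
  have L1: "1 \<le> L" using K0 c0 X0 by (simp add: L_def)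
  have LX: "K + 1 \<le> c * L * X"
  proof -
    have "c * L * X = K + 1 + c * X" using c0 X0 by (simp add: L_def field_simps)
    then show ?thesis using c0 X0 by simp
  qed
  define D where "D = c * (L + r0) * Q"
  have D0: "0 < D" using c0 L1 r0 Q0 by (simp add: D_def)
  have "1 / D \<le> integral {t - L..t + r0} (\<rho> t)" if t: "0 \<le> t" for t
  proof -
    obtain r1 where r1: "0 < r1" "\<And>s. s \<in> {0..t} \<Longrightarrow> supported_in (f s) r1"
      using uniform_support[OF t] by blast
    define r where "r = max r0 r1"
    have r: "0 < r" using r0 by (simp add: r_def)
    have S: "supported_in (f s) r" if "s \<in> {0..t}" for s
      using supported_in_mono[OF r1(2)[OF that]] by (simp add: r_def)
    have St: "supported_in (f t) r" using S t by simp
    have S0r: "supported_in (f 0) r" using S t by simp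
    define A where "A = (\<lambda>s x. cutoff (E s x) * (c * (x - s) * mom (\<lambda>_. 1) r s x + mom weight r s x))"
    have mono: "integral {- r..r} (A 0) \<le> integral {- r..r} (A t)"
      by (rule functional_monotone[OF t S r S0 c_def A_def])
    have cut: "0 \<le> cutoff (E s x)" "cutoff (E s x) \<le> Q" if "0 \<le> s" for s x
      using cutoff_bounds(1) cutoff_bounds(3)[of "E s x"] abs_field_le[OF that, of x] mass_constant[OF that]
      by (auto simp: Q_def)
    have cE: "continuous_on {- r..r} (E s)" if s: "s \<in> {0..t}" for s
      using field_deriv_x[of s r] S[OF s] s by (intro DERIV_continuous_on) auto
    have iA: "A s integrable_on {- r..r}" if s: "s \<in> {0..t}" for s
      unfolding A_def using s
      by (intro integrable_continuous_real continuous_intros continuous_on_compose2[OF continuous_on_cutoff(1)] cE) auto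
    have ir: "\<rho> t integrable_on {a..b}" for a b
      by (intro integrable_continuous_real rho_continuous[OF t])
    have "- K = integral {- r..r} (\<lambda>x. - (Q * B) * \<rho> 0 x)"
      unfolding Henstock_Kurzweil_Integration.integral_mult_right
      by (simp add: K_def mass_eq[OF order_refl S0r])
    also have "\<dots> \<le> integral {- r..r} (A 0)"
    proof (rule integral_le)
      show "(\<lambda>x. - (Q * B) * \<rho> 0 x) integrable_on {- r..r}"
        by (intro integrable_continuous_real continuous_intros rho_continuous) auto
      show "A 0 integrable_on {- r..r}" using iA[of 0] t by simp
      fix x assume "x \<in> {- r..r}"
      have \<rho>: "mom (\<lambda>_. 1) r 0 x = \<rho> 0 x" using rho_eq_mom[OF order_refl S0r] by simp
      have \<rho>0: "0 \<le> \<rho> 0 x" using rho_nonneg[OF order_refl] .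
      have "- (1 + 3 * r0) * \<rho> 0 x = mom (\<lambda>v. - (1 + 3 * r0) * 1) r 0 x" unfolding mom_scale \<rho> ..
      also have "\<dots> \<le> mom weight r 0 x"
      proof (intro mom_mono order_refl continuous_intros)
        fix v assume v: "f 0 x v \<noteq> 0"
        obtain u w where "v = (u, w)" by (cases v)
        then show "- (1 + 3 * r0) * 1 \<le> weight v"
          using weight_ge[of v] S0 v by (force simp: supported_in_def)
      qed
      finally have w: "- (1 + 3 * r0) * \<rho> 0 x \<le> mom weight r 0 x" .
      have "- r0 * \<rho> 0 x \<le> x * \<rho> 0 x"
      proof (cases "r0 \<le> \<bar>x\<bar>")
        case True
        then show ?thesis using rho_zero[OF order_refl S0 True] by simp
      next
        case False
        then show ?thesis using \<rho>0 by (intro mult_right_mono) auto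
      qed
      then have "c * (- r0 * \<rho> 0 x) \<le> c * (x * \<rho> 0 x)" using c0 by (intro mult_left_mono) auto
      with w have "- B * \<rho> 0 x \<le> c * (x - 0) * mom (\<lambda>_. 1) r 0 x + mom weight r 0 x" (is "_ \<le> ?S")
        by (simp add: B_def \<rho> algebra_simps)
      then have "cutoff (E 0 x) * (- B * \<rho> 0 x) \<le> cutoff (E 0 x) * ?S"
        using cut by (intro mult_left_mono) auto
      moreover have "Q * (- B * \<rho> 0 x) \<le> cutoff (E 0 x) * (- B * \<rho> 0 x)"
        using cut B0 \<rho>0 by (intro mult_right_mono_neg) (auto simp: mult_nonneg_nonneg)
      ultimately show "- (Q * B) * \<rho> 0 x \<le> A 0 x" by (simp add: A_def mult.assoc)
    qed
    also have "\<dots> \<le> integral {- r..r} (A t)" by (rule mono)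
    \<comment> \<open>Behind the window \<open>c * (x - t)\<close> is below
      \<open>- (c * L)\<close>. Inside it exceeds that value by at most \<open>c * (L + r0)\<close>,
      which with the bound \<open>Q\<close> of the cutoff gives \<open>D\<close>. Ahead of the
      window there is no charge.\<close>
    also have "\<dots> \<le> integral {- r..r} (\<lambda>x. - (c * L) * (cutoff (E t x) * \<rho> t x)
        + D * (if x \<in> {t - L..t + r0} then \<rho> t x else 0))"
    proof (rule integral_le)
      show "A t integrable_on {- r..r}" using iA[of t] t by simp
      have "(\<lambda>x. if x \<in> {t - L..t + r0} then \<rho> t x else 0) integrable_on {- r..r}"
        unfolding integrable_restrict_Int by (simp add: Int_atLeastAtMost ir)
      moreover have "(\<lambda>x. cutoff (E t x) * \<rho> t x) integrable_on {- r..r}"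
        using t by (intro integrable_continuous_real continuous_intros rho_continuous
            continuous_on_compose2[OF continuous_on_cutoff(1)] cE) auto
      ultimately show "(\<lambda>x. - (c * L) * (cutoff (E t x) * \<rho> t x)
        + D * (if x \<in> {t - L..t + r0} then \<rho> t x else 0)) integrable_on {- r..r}"
        by (intro integrable_add integrable_on_mult_right)
      fix x assume "x \<in> {- r..r}"
      have \<rho>: "mom (\<lambda>_. 1) r t x = \<rho> t x" using rho_eq_mom[OF t St] by simp
      have \<rho>0: "0 \<le> \<rho> t x" using rho_nonneg[OF t] .
      have "mom weight r t x \<le> mom (\<lambda>v. 0) r t x"
        by (intro mom_mono t continuous_intros weight_nonpos)
      then have w: "mom weight r t x \<le> 0" by (simp add: mom_def)
      have a: "A t x \<le> c * (x - t) * (cutoff (E t x) * \<rho> t x)"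
        using mult_left_mono[OF w cut(1)[OF t, of x]] by (simp add: A_def \<rho> algebra_simps)
      have C: "0 \<le> cutoff (E t x) * \<rho> t x" using cut(1)[OF t] \<rho>0 by simp
      show "A t x \<le> - (c * L) * (cutoff (E t x) * \<rho> t x) + D * (if x \<in> {t - L..t + r0} then \<rho> t x else 0)"
      proof -
        consider "x < t - L" | "x \<in> {t - L..t + r0}" | "t + r0 < x" by fastforce
        then show ?thesis
        proof cases
          case 1
          have "c * (x - t) \<le> c * (- L)" using c0 1 by (intro mult_left_mono) auto
          from mult_right_mono[OF this C] show ?thesis using a 1 by simp
        next
          case 2
          have "c * (x - t) + c * L \<le> c * (L + r0)"
            using mult_left_mono[of "x - t" r0 c] c0 2 by (simp add: algebra_simps)
          then have "(c * (x - t) + c * L) * (cutoff (E t x) * \<rho> t x) \<le> c * (L + r0) * (Q * \<rho> t x)"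
            using cut[OF t, of x] \<rho>0 c0 L1 r0 C by (intro mult_mono mult_right_mono) auto
          then show ?thesis using a 2 by (simp add: D_def algebra_simps)
        next
          case 3
          have "f t x v = 0" for v using support_forward(1)[OF t S0, of x] 3 by (cases v) force
          then have "\<rho> t x = 0" by (simp add: charge_density_def)
          then show ?thesis using a 3 by simp
        qed
      qed
    qed
    also have "\<dots> = - (c * L) * X + D * integral ({t - L..t + r0} \<inter> {- r..r}) (\<rho> t)"
    proof -
      have "(\<lambda>x. if x \<in> {t - L..t + r0} then \<rho> t x else 0) integrable_on {- r..r}"
        unfolding integrable_restrict_Int by (simp add: Int_atLeastAtMost ir)
      moreover have "(\<lambda>x. cutoff (E t x) * \<rho> t x) integrable_on {- r..r}"
        using t by (intro integrable_continuous_real continuous_intros rho_continuous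
            continuous_on_compose2[OF continuous_on_cutoff(1)] cE) auto
      ultimately have "((\<lambda>x. - (c * L) * (cutoff (E t x) * \<rho> t x)
        + D * (if x \<in> {t - L..t + r0} then \<rho> t x else 0)) has_integral
        - (c * L) * integral {- r..r} (\<lambda>x. cutoff (E t x) * \<rho> t x) +
        D * integral {- r..r} (\<lambda>x. if x \<in> {t - L..t + r0} then \<rho> t x else 0)) {- r..r}"
        by (intro has_integral_add has_integral_mult_right integrable_integral)
      from integral_unique[OF this] show ?thesis
        unfolding integral_cutoff_density[OF t St r] X_def[symmetric] integral_restrict_Int .
    qed
    also have "integral ({t - L..t + r0} \<inter> {- r..r}) (\<rho> t) \<le> integral {t - L..t + r0} (\<rho> t)"
      by (rule integral_subset_le) (use rho_nonneg[OF t] in \<open>auto simp: Int_atLeastAtMost ir\<close>)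
    finally have "- K \<le> - (c * L) * X + D * integral {t - L..t + r0} (\<rho> t)"
      using D0 by (simp add: mult_left_mono)
    with LX have "1 \<le> D * integral {t - L..t + r0} (\<rho> t)" by simp
    then show ?thesis using D0 by (simp add: field_simps)
  qed
  then show ?thesis using D0 L1 r0 by (intro exI[of _ "1 / D"] conjI exI[of _ L] exI[of _ r0]) auto
qed

lemma Lp_norm_rho_bounded_below:
  assumes "0 < mass 0"
  shows "\<exists>C>0. \<forall>t\<ge>0. \<forall>p\<in>{1..\<infinity>}. ennreal C \<le> Lp_norm p (\<rho> t)"
proof -
  obtain \<delta> L R where *: "0 < \<delta>" "1 \<le> L + R" "\<And>t. 0 \<le> t \<Longrightarrow> \<delta> \<le> integral {t - L..t + R} (\<rho> t)"
    using density_in_moving_window[OF assms] by auto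
  have "ennreal (\<delta> / (L + R)) \<le> Lp_norm p (\<rho> t)" if t: "0 \<le> t" and p: "p \<in> {1..\<infinity>}" for t p
  proof -
    obtain r where r: "supported_in (f t) r" using supp[OF t] by auto
    have "ennreal (\<delta> / ((t + R) - (t - L))) \<le> Lp_norm p (\<rho> t)"
      by (rule Lp_norm_ge_average[OF rho_continuous[OF t] rho_nonneg[OF t] _ _ *(1,3) p, of r])
        (use rho_zero[OF t r] * t in auto)
    then show ?thesis by (simp add: add.commute)
  qed
  then show ?thesis using *(1,2) by (intro exI[of _ "\<delta> / (L + R)"]) auto
qed

end

subsection \<open>Global solutions\<close>

text \<open>Nontriviality of the filter makes \<open>vector_derivative\<close> in the Vlasov
  equation agree with the one-sided derivative, also at time 0.\<close>

lemma at_within_Ici_neq_bot: "(a::real) \<le> t \<Longrightarrow> at t within {a..} \<noteq> bot"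
  using at_within_Ici_at_right[of a] at_within_interior[of t "{a..}"]
  by (cases "t = a") auto

lemma compactly_supported_imp_supported_in:
  assumes "compactly_supported (\<lambda>(x, v). g x v)"
  shows "\<exists>r>0. supported_in g r"
proof -
  obtain b where b: "\<And>p. p \<in> closure (support_on UNIV (\<lambda>(x, v). g x v)) \<Longrightarrow> norm p \<le> b"
    using compact_imp_bounded[OF assms[unfolded compactly_supported_def]] unfolding bounded_iff by blast
  \<comment> \<open>Adding 1 makes the bounds strict and the radius positive.\<close>
  have "\<bar>x\<bar> < \<bar>b\<bar> + 1 \<and> \<bar>u\<bar> < \<bar>b\<bar> + 1 \<and> \<bar>w\<bar> < \<bar>b\<bar> + 1" if "g x (u, w) \<noteq> 0" for x u w
  proof -
    have "(x, u, w) \<in> support_on UNIV (\<lambda>(x, v). g x v)" using that by (simp add: support_on_def)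
    then have "norm (x, u, w) \<le> b" using b closure_subset by blast
    then show ?thesis
      using norm_fst_le[of x "(u, w)"] norm_snd_le[of "(u, w)" x] norm_fst_le[of u w] norm_snd_le[of w u] by auto
  qed
  then show ?thesis by (intro exI[of _ "\<bar>b\<bar> + 1"]) (simp add: supported_in_def)
qed

text \<open>The partial derivatives are the values of the total derivative at the unit vectors, so
  they inherit its continuity.\<close>

lemma global_solution_imp_vlasov_poisson:
  assumes "global_solution f0 f"
  shows "\<exists>ft fx fu fw. vlasov_poisson f ft fx fu fw"
proof -
  let ?F = "\<lambda>(t, x, v). f t x v"
  have "?F continuously_differentiable_on ({0..} \<times> UNIV)"
    using assms unfolding global_solution_def by (rule conjunct1)
  then obtain D :: "real \<times> real \<times> real \<times> real \<Rightarrow> (real \<times> real \<times> real \<times> real) \<Rightarrow>\<^sub>L real" where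
    D': "\<forall>z\<in>{0..} \<times> UNIV. (?F has_derivative blinfun_apply (D z)) (at z within {0..} \<times> UNIV)"
    and cD: "continuous_on ({0..} \<times> UNIV) D"
    unfolding continuously_differentiable_on_def by (elim exE conjE)
  note D = bspec[OF D']
  define ft fx fu fw where "ft = (\<lambda>t x v. D (t, x, v) (1, 0, 0, 0))" and "fx = (\<lambda>t x v. D (t, x, v) (0, 1, 0, 0))"
    and "fu = (\<lambda>t x v. D (t, x, v) (0, 0, 1, 0))" and "fw = (\<lambda>t x v. D (t, x, v) (0, 0, 0, 1))"
  have lin: "blinfun_apply B (a, b, c, d) = blinfun_apply B (1, 0, 0, 0) * a + blinfun_apply B (0, 1, 0, 0) * b
      + blinfun_apply B (0, 0, 1, 0) * c + blinfun_apply B (0, 0, 0, 1) * d"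
    for B :: "(real \<times> real \<times> real \<times> real) \<Rightarrow>\<^sub>L real" and a b c d
  proof -
    have eq: "(a, b, c, d) = a *\<^sub>R (1, 0, 0, 0) + b *\<^sub>R (0, 1, 0, 0) + c *\<^sub>R (0, 0, 1, 0) + d *\<^sub>R (0, 0, 0, 1::real)"
      by simp
    show ?thesis
      by (subst eq) (simp only: blinfun.add_right blinfun.scaleR_right real_scaleR_def mult.commute)
  qed
  have cont: "continuous_on ({0..} \<times> UNIV) (\<lambda>(t, x, v). D (t, x, v) e)" for e
    using bounded_linear.continuous_on[OF blinfun.bounded_linear_left cD, of e] by (simp add: case_prod_beta)
  interpret C1_density f ft fx fu fw
  proof
    fix t x u w :: real assume "0 \<le> t"
    then have "((\<lambda>(t, x, v). f t x v) has_derivative blinfun_apply (D (t, x, u, w))) (at (t, x, u, w) within {0..} \<times> UNIV)"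
      by (intro D) auto
    then show "((\<lambda>(t, x, v). f t x v) has_derivative
      (\<lambda>(a, b, c, d). ft t x (u, w) * a + fx t x (u, w) * b + fu t x (u, w) * c + fw t x (u, w) * d))
      (at (t, x, u, w) within {0..} \<times> UNIV)"
      by (rule has_derivative_eq_rhs) (auto simp: fun_eq_iff ft_def fx_def fu_def fw_def intro: lin)
  qed (use cont in \<open>simp_all add: ft_def fx_def fu_def\<close>)
  have "vlasov_poisson f ft fx fu fw"
  proof
    fix t x :: real and v :: "real \<times> real" assume t: "0 \<le> t"
    obtain u w where v: "v = (u, w)" by (cases v)
    have "vector_derivative (\<lambda>s. f s x (u, w)) (at t within {0..}) = ft t x (u, w)"
      using deriv_t[OF t, of x "(u, w)"]
      by (intro vector_derivative_within at_within_Ici_neq_bot t)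
        (simp add: has_real_derivative_iff_has_vector_derivative)
    moreover have "deriv (\<lambda>y. f t y (u, w)) x = fx t x (u, w)"
      by (rule DERIV_imp_deriv[OF deriv_x[OF t]])
    moreover have "deriv (\<lambda>z. f t x (z, w)) u = fu t x (u, w)"
      by (rule DERIV_imp_deriv[OF deriv_u[OF t]])
    moreover have "vector_derivative (\<lambda>s. f s x (u, w)) (at t within {0..})
        + fst (rel_velocity (u, w)) * deriv (\<lambda>y. f t y (u, w)) x
        + electric_field f t x * deriv (\<lambda>z. f t x (z, w)) u = 0"
      using assms t by (simp add: global_solution_def vlasov_equation_def)
    ultimately show "ft t x v + vhat v * fx t x v + electric_field f t x * fu t x v = 0"
      by (simp add: v rel_velocity_eq_vhat)
    show "0 \<le> f t x v" using assms t unfolding global_solution_def by metis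
  next
    fix t :: real assume "0 \<le> t"
    then show "\<exists>r>0. supported_in (f t) r"
      using assms by (intro compactly_supported_imp_supported_in) (simp add: global_solution_def)
  qed
  then show ?thesis by blast
qed

theorem theorem1p1:
  fixes f0 :: "real \<Rightarrow> real \<times> real \<Rightarrow> real"
    and f :: "real \<Rightarrow> real \<Rightarrow> real \<times> real \<Rightarrow> real"
  assumes "(\<lambda>(x, v). f0 x v) continuously_differentiable_on UNIV"
    and "compactly_supported (\<lambda>(x, v). f0 x v)"
    and "\<forall>x v. f0 x v \<ge> 0"
    and "\<exists>x v. f0 x v \<noteq> 0"
    and "global_solution f0 f"
  shows "\<exists>C::real. C > 0 \<and>
           (\<forall>t\<ge>0. \<forall>p\<in>{1..\<infinity>}. Lp_norm p (charge_density f t) \<ge> ennreal C)"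
proof -
  obtain ft fx fu fw where "vlasov_poisson f ft fx fu fw"
    using global_solution_imp_vlasov_poisson[OF assms(5)] by blast
  then interpret vlasov_poisson f ft fx fu fw .
  obtain x v where "f 0 x v \<noteq> 0"
    using assms(4,5) by (auto simp: global_solution_def)
  from Lp_norm_rho_bounded_below[OF mass_pos[OF this]] show ?thesis .
qed

end
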